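(* Let $q$ be a prime power and $G=\langle x,y\mid x^n=1,\ y^2=1,\ xy=yx^s\rangle$, where $s$ is a positive integer with $s^2\equiv1\pmod n$ and $\gcd(2n,q)=1$; let $d=\gcd(n,s-1)$. Let $f(x)$ be an $s$-self-involutive monic irreducible factor of $\frac{x^n-1}{x^d-1}$ in $\mathbb F_q[x]$, and let $\ell(x)\in\mathbb F_q[x]$ satisfy $(x^{s-1}-1)\ell(x)\equiv1\pmod{f(x)}$. Then $$e_{f,1}=-\frac1n((f^* )')^*(x)\cdot\frac{x^n-1}{f(x)}\cdot\bigl[\ell(x)(1-y)+1\bigr]\quad\text{and}\quad e_{f,2}=\frac1n((f^* )')^*(x)\cdot\frac{x^n-1}{f(x)}\cdot\ell(x)(1-y)$$ are non-central primitive idempotents of $\mathbb F_qG$.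
   Context: Polynomials in $x$ are viewed as elements of $\mathbb F_qG$ by substituting the group element $x$. $g^*(x)=x^{\deg g}g(1/x)$ denotes the reciprocal polynomial, $'$ the formal derivative, and the outer reciprocal of $(f^* )'$ is taken with respect to degree $\deg f-1$ (so that $-\frac1n((f^* )')^*\cdot\frac{x^n-1}{f}$ is the idempotent of $\mathbb F_q[x]/(x^n-1)$ congruent to $1$ mod $f$ and $0$ mod $(x^n-1)/f$). For a monic $g(x)=(x-a_1)\cdots(x-a_k)$ with $g(0)\ne0$ and $s^2\equiv1\pmod{\mathrm{ord}(g)}$ (where $\mathrm{ord}(g)$ is the least $N\ge1$ with $g\mid x^N-1$), $g^{*_s}(x)=(x-a_1^s)\cdots(x-a_k^s)$, and $g$ is $s$-self-involutive if $g$ and $g^{*_s}$ have the same roots. *)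

theory Defs
  imports
    "HOL-Number_Theory.Number_Theory"
    "HOL-Number_Theory.Prime_Powers"
    "HOL-Library.Cardinality"
    "HOL-Algebra.Algebraic_Closure_Type"
begin

section \<open>Groups given by generators and relations\<close>

text \<open>A letter \<open>(a, True)\<close> stands for the generator \<open>a\<close>, and \<open>(a, False)\<close> for its formal
  inverse. A relation \<open>u = v\<close> is represented by the pair \<open>(u, v)\<close>.\<close>

type_synonym 'a gword = "('a \<times> bool) list"

inductive pres_eq :: "('a gword \<times> 'a gword) set \<Rightarrow> 'a gword \<Rightarrow> 'a gword \<Rightarrow> bool"
  for R where
  rel: "(u, v) \<in> R \<Longrightarrow> pres_eq R u v"
| cancel: "pres_eq R [(a, b), (a, \<not> b)] []"
| refl: "pres_eq R u u"
| sym: "pres_eq R u v \<Longrightarrow> pres_eq R v u"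
| trans: "pres_eq R u v \<Longrightarrow> pres_eq R v w \<Longrightarrow> pres_eq R u w"
| append: "pres_eq R u v \<Longrightarrow> pres_eq R u' v' \<Longrightarrow> pres_eq R (u @ u') (v @ v')"

definition pres_class :: "('a gword \<times> 'a gword) set \<Rightarrow> 'a gword \<Rightarrow> 'a gword set" where
  "pres_class R u = {v. pres_eq R u v}"

definition presented_group :: "('a gword \<times> 'a gword) set \<Rightarrow> 'a gword set monoid" where
  "presented_group R =
     \<lparr>carrier = range (pres_class R),
      mult = (\<lambda>A B. \<Union>u\<in>A. \<Union>v\<in>B. pres_class R (u @ v)),
      one = pres_class R []\<rparr>"

lemma pres_class_eq_iff: "pres_class R u = pres_class R v \<longleftrightarrow> pres_eq R u v"
  unfolding pres_class_def set_eq_iff mem_Collect_eq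
  by (metis pres_eq.refl pres_eq.sym pres_eq.trans)

lemma presented_group_mult:
  "pres_class R u \<otimes>\<^bsub>presented_group R\<^esub> pres_class R v = pres_class R (u @ v)"
proof -
  have "pres_class R (u' @ v') = pres_class R (u @ v)"
    if "u' \<in> pres_class R u" "v' \<in> pres_class R v" for u' v'
    using that unfolding pres_class_eq_iff
    by (metis mem_Collect_eq pres_class_def pres_eq.append pres_eq.sym)
  moreover have "u \<in> pres_class R u" "v \<in> pres_class R v"
    by (simp_all add: pres_class_def pres_eq.refl)
  ultimately have "(\<Union>u'\<in>pres_class R u. \<Union>v'\<in>pres_class R v. pres_class R (u' @ v'))
      = pres_class R (u @ v)"
    by blast
  then show ?thesis
    by (simp add: presented_group_def)
qed

lemma pres_eq_inverse_word:
  "pres_eq R (rev (map (\<lambda>(a, b). (a, \<not> b)) u) @ u) []"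
proof (induction u)
  case Nil
  show ?case by (simp add: pres_eq.refl)
next
  case (Cons p u)
  obtain a b where p: "p = (a, b)" by force
  let ?w = "rev (map (\<lambda>(a, b). (a, \<not> b)) u)"
  have "pres_eq R [(a, \<not> b), (a, b)] []"
    using pres_eq.cancel[of R a "\<not> b"] by simp
  from pres_eq.append[OF pres_eq.refl[of R ?w] pres_eq.append[OF this pres_eq.refl[of R u]]]
  have "pres_eq R (?w @ [(a, \<not> b), (a, b)] @ u) (?w @ u)"
    by simp
  from pres_eq.trans[OF this Cons.IH] show ?case
    by (simp add: p)
qed

lemma group_presented_group: "group (presented_group R)"
proof (rule groupI)
  fix A B C
  assume "A \<in> carrier (presented_group R)" "B \<in> carrier (presented_group R)"
    "C \<in> carrier (presented_group R)"
  then obtain u v w where "A = pres_class R u" "B = pres_class R v" "C = pres_class R w"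
    by (auto simp: presented_group_def)
  then show "A \<otimes>\<^bsub>presented_group R\<^esub> B \<otimes>\<^bsub>presented_group R\<^esub> C =
      A \<otimes>\<^bsub>presented_group R\<^esub> (B \<otimes>\<^bsub>presented_group R\<^esub> C)"
    by (simp add: presented_group_mult)
next
  fix A B
  assume "A \<in> carrier (presented_group R)" "B \<in> carrier (presented_group R)"
  then obtain u v where "A = pres_class R u" "B = pres_class R v"
    by (auto simp: presented_group_def)
  then have "A \<otimes>\<^bsub>presented_group R\<^esub> B = pres_class R (u @ v)"
    by (simp add: presented_group_mult)
  then show "A \<otimes>\<^bsub>presented_group R\<^esub> B \<in> carrier (presented_group R)"
    by (simp add: presented_group_def)
next
  show "\<one>\<^bsub>presented_group R\<^esub> \<in> carrier (presented_group R)"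
    by (simp add: presented_group_def)
next
  fix A
  assume "A \<in> carrier (presented_group R)"
  then obtain u where A: "A = pres_class R u"
    by (auto simp: presented_group_def)
  have one: "\<one>\<^bsub>presented_group R\<^esub> = pres_class R []"
    by (simp add: presented_group_def)
  show "\<one>\<^bsub>presented_group R\<^esub> \<otimes>\<^bsub>presented_group R\<^esub> A = A"
    by (simp add: A one presented_group_mult)
  show "\<exists>B\<in>carrier (presented_group R). B \<otimes>\<^bsub>presented_group R\<^esub> A = \<one>\<^bsub>presented_group R\<^esub>"
  proof
    let ?B = "pres_class R (rev (map (\<lambda>(a, b). (a, \<not> b)) u))"
    show "?B \<otimes>\<^bsub>presented_group R\<^esub> A = \<one>\<^bsub>presented_group R\<^esub>"
      by (simp add: A one presented_group_mult pres_class_eq_iff pres_eq_inverse_word)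
    show "?B \<in> carrier (presented_group R)"
      by (simp add: presented_group_def)
  qed
qed

datatype gen = Gen_x | Gen_y

definition split_relations :: "nat \<Rightarrow> nat \<Rightarrow> (gen gword \<times> gen gword) set" where
  "split_relations n s =
     (let x = (Gen_x, True); y = (Gen_y, True)
      in {(replicate n x, []), ([y, y], []), ([x, y], y # replicate s x)})"

definition split_group :: "nat \<Rightarrow> nat \<Rightarrow> gen gword set monoid" where
  "split_group n s = presented_group (split_relations n s)"

definition split_x :: "nat \<Rightarrow> nat \<Rightarrow> gen gword set" where
  "split_x n s = pres_class (split_relations n s) [(Gen_x, True)]"

definition split_y :: "nat \<Rightarrow> nat \<Rightarrow> gen gword set" where
  "split_y n s = pres_class (split_relations n s) [(Gen_y, True)]"

section \<open>Group algebras\<close>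

definition group_algebra :: "('g, 'm) monoid_scheme \<Rightarrow> ('g \<Rightarrow> 'a::comm_ring_1) ring" where
  "group_algebra G =
     \<lparr>carrier = {a. finite {g. a g \<noteq> 0} \<and> {g. a g \<noteq> 0} \<subseteq> carrier G},
      mult = (\<lambda>a b g. if g \<in> carrier G
                then \<Sum>h | a h \<noteq> 0. a h * b (inv\<^bsub>G\<^esub> h \<otimes>\<^bsub>G\<^esub> g) else 0),
      one = (\<lambda>g. if g = \<one>\<^bsub>G\<^esub> then 1 else 0),
      zero = (\<lambda>g. 0),
      add = (\<lambda>a b g. a g + b g)\<rparr>"

lemma group_algebra_mult_superset:
  assumes "finite S" "{h. a h \<noteq> 0} \<subseteq> S" "g \<in> carrier G"
  shows "(a \<otimes>\<^bsub>group_algebra G\<^esub> b) g = (\<Sum>h\<in>S. a h * b (inv\<^bsub>G\<^esub> h \<otimes>\<^bsub>G\<^esub> g))"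
proof -
  have "(\<Sum>h | a h \<noteq> 0. a h * b (inv\<^bsub>G\<^esub> h \<otimes>\<^bsub>G\<^esub> g)) = (\<Sum>h\<in>S. a h * b (inv\<^bsub>G\<^esub> h \<otimes>\<^bsub>G\<^esub> g))"
    by (rule sum.mono_neutral_left) (use assms in auto)
  then show ?thesis
    using assms by (simp add: group_algebra_def)
qed

lemma ring_group_algebra:
  fixes G :: "('g, 'm) monoid_scheme"
  assumes "group G"
  shows "ring (group_algebra G :: ('g \<Rightarrow> 'a::comm_ring_1) ring)"
proof -
  interpret group G by fact
  let ?A = "group_algebra G :: ('g \<Rightarrow> 'a) ring"
  have car: "a \<in> carrier ?A \<longleftrightarrow> finite {g. a g \<noteq> 0} \<and> {g. a g \<noteq> 0} \<subseteq> carrier G" for a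
    by (simp add: group_algebra_def)
  have outside: "(a \<otimes>\<^bsub>?A\<^esub> b) g = 0" if "g \<notin> carrier G" for a b g
    using that by (simp add: group_algebra_def)
  have add: "a \<oplus>\<^bsub>?A\<^esub> b = (\<lambda>g. a g + b g)" for a b
    by (simp add: group_algebra_def)
  have one: "\<one>\<^bsub>?A\<^esub> = (\<lambda>g. if g = \<one>\<^bsub>G\<^esub> then 1 else 0)"
    by (simp add: group_algebra_def)
  have zero: "\<zero>\<^bsub>?A\<^esub> = (\<lambda>g. 0)"
    by (simp add: group_algebra_def)
  have add_closed: "a \<oplus>\<^bsub>?A\<^esub> b \<in> carrier ?A" if "a \<in> carrier ?A" "b \<in> carrier ?A" for a b
  proof -
    have "{g. a g + b g \<noteq> 0} \<subseteq> {g. a g \<noteq> 0} \<union> {g. b g \<noteq> 0}" by auto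
    with that show ?thesis
      unfolding car add by (blast intro: finite_subset)
  qed
  have supp_mult: "{g. (a \<otimes>\<^bsub>?A\<^esub> b) g \<noteq> 0} \<subseteq>
      (\<lambda>(h, k). h \<otimes>\<^bsub>G\<^esub> k) ` ({g. a g \<noteq> 0} \<times> {g. b g \<noteq> 0})"
    if a: "a \<in> carrier ?A" for a b
  proof
    fix g assume "g \<in> {g. (a \<otimes>\<^bsub>?A\<^esub> b) g \<noteq> 0}"
    then have nz: "(a \<otimes>\<^bsub>?A\<^esub> b) g \<noteq> 0" by simp
    then have g: "g \<in> carrier G" using outside by blast
    then have "(\<Sum>h | a h \<noteq> 0. a h * b (inv\<^bsub>G\<^esub> h \<otimes>\<^bsub>G\<^esub> g)) \<noteq> 0"
      using nz by (simp add: group_algebra_def)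
    then obtain h where h: "a h \<noteq> 0" "a h * b (inv\<^bsub>G\<^esub> h \<otimes>\<^bsub>G\<^esub> g) \<noteq> 0"
      by (elim sum.not_neutral_contains_not_neutral) simp
    then have "b (inv\<^bsub>G\<^esub> h \<otimes>\<^bsub>G\<^esub> g) \<noteq> 0" by auto
    moreover have "h \<in> carrier G" using a h(1) car by blast
    then have "g = h \<otimes>\<^bsub>G\<^esub> (inv\<^bsub>G\<^esub> h \<otimes>\<^bsub>G\<^esub> g)"
      using g by (simp add: m_assoc[symmetric])
    ultimately show "g \<in> (\<lambda>(h, k). h \<otimes>\<^bsub>G\<^esub> k) ` ({g. a g \<noteq> 0} \<times> {g. b g \<noteq> 0})"
      using h(1) by (intro image_eqI[of _ _ "(h, inv\<^bsub>G\<^esub> h \<otimes>\<^bsub>G\<^esub> g)"]) auto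
  qed
  have mult_closed: "a \<otimes>\<^bsub>?A\<^esub> b \<in> carrier ?A" if "a \<in> carrier ?A" "b \<in> carrier ?A" for a b
  proof -
    have "finite {g. (a \<otimes>\<^bsub>?A\<^esub> b) g \<noteq> 0}"
      by (rule finite_subset[OF supp_mult[OF that(1)]]) (use that car in auto)
    moreover have "{g. (a \<otimes>\<^bsub>?A\<^esub> b) g \<noteq> 0} \<subseteq> carrier G"
      using outside by auto
    ultimately show ?thesis by (simp add: car)
  qed
  have assoc: "a \<otimes>\<^bsub>?A\<^esub> b \<otimes>\<^bsub>?A\<^esub> c = a \<otimes>\<^bsub>?A\<^esub> (b \<otimes>\<^bsub>?A\<^esub> c)"
    if a: "a \<in> carrier ?A" and b: "b \<in> carrier ?A" for a b c
  proof
    fix g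
    show "(a \<otimes>\<^bsub>?A\<^esub> b \<otimes>\<^bsub>?A\<^esub> c) g = (a \<otimes>\<^bsub>?A\<^esub> (b \<otimes>\<^bsub>?A\<^esub> c)) g"
    proof (cases "g \<in> carrier G")
      case g: True
      define Sa where "Sa = {g. a g \<noteq> 0}"
      define Sb where "Sb = {g. b g \<noteq> 0}"
      define S where "S = (\<lambda>(h, k). h \<otimes>\<^bsub>G\<^esub> k) ` (Sa \<times> Sb)"
      have fin: "finite Sa" "finite Sb" "finite S" and
        sub: "Sa \<subseteq> carrier G" "Sb \<subseteq> carrier G"
        using a b by (auto simp: Sa_def Sb_def S_def car)
      have subS: "S \<subseteq> carrier G"
        using sub by (auto simp: S_def)
      have inner: "(\<Sum>h\<in>S. b (inv\<^bsub>G\<^esub> k \<otimes>\<^bsub>G\<^esub> h) * c (inv\<^bsub>G\<^esub> h \<otimes>\<^bsub>G\<^esub> g))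
          = (b \<otimes>\<^bsub>?A\<^esub> c) (inv\<^bsub>G\<^esub> k \<otimes>\<^bsub>G\<^esub> g)" if k: "k \<in> Sa" for k
      proof -
        have kc: "k \<in> carrier G" using k sub by auto
        have "(b \<otimes>\<^bsub>?A\<^esub> c) (inv\<^bsub>G\<^esub> k \<otimes>\<^bsub>G\<^esub> g)
            = (\<Sum>m\<in>Sb. b m * c (inv\<^bsub>G\<^esub> m \<otimes>\<^bsub>G\<^esub> (inv\<^bsub>G\<^esub> k \<otimes>\<^bsub>G\<^esub> g)))"
          by (rule group_algebra_mult_superset) (use fin kc g in \<open>auto simp: Sb_def\<close>)
        also have "\<dots> = (\<Sum>h\<in>(\<lambda>m. k \<otimes>\<^bsub>G\<^esub> m) ` Sb.
            b (inv\<^bsub>G\<^esub> k \<otimes>\<^bsub>G\<^esub> h) * c (inv\<^bsub>G\<^esub> h \<otimes>\<^bsub>G\<^esub> g))"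
        proof (subst sum.reindex)
          show "inj_on (\<lambda>m. k \<otimes>\<^bsub>G\<^esub> m) Sb"
            using kc sub by (intro inj_onI) (metis l_cancel subsetD)
          show "(\<Sum>m\<in>Sb. b m * c (inv\<^bsub>G\<^esub> m \<otimes>\<^bsub>G\<^esub> (inv\<^bsub>G\<^esub> k \<otimes>\<^bsub>G\<^esub> g))) =
              sum ((\<lambda>h. b (inv\<^bsub>G\<^esub> k \<otimes>\<^bsub>G\<^esub> h) * c (inv\<^bsub>G\<^esub> h \<otimes>\<^bsub>G\<^esub> g)) \<circ> (\<lambda>m. k \<otimes>\<^bsub>G\<^esub> m)) Sb"
          proof (rule sum.cong)
            fix m assume "m \<in> Sb"
            then have m: "m \<in> carrier G" using sub by auto
            have "inv\<^bsub>G\<^esub> k \<otimes>\<^bsub>G\<^esub> (k \<otimes>\<^bsub>G\<^esub> m) = m"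
              using kc m by (simp add: m_assoc[symmetric])
            moreover have "inv\<^bsub>G\<^esub> (k \<otimes>\<^bsub>G\<^esub> m) \<otimes>\<^bsub>G\<^esub> g = inv\<^bsub>G\<^esub> m \<otimes>\<^bsub>G\<^esub> (inv\<^bsub>G\<^esub> k \<otimes>\<^bsub>G\<^esub> g)"
              using kc m g by (simp add: inv_mult_group m_assoc)
            ultimately show "b m * c (inv\<^bsub>G\<^esub> m \<otimes>\<^bsub>G\<^esub> (inv\<^bsub>G\<^esub> k \<otimes>\<^bsub>G\<^esub> g)) =
              ((\<lambda>h. b (inv\<^bsub>G\<^esub> k \<otimes>\<^bsub>G\<^esub> h) * c (inv\<^bsub>G\<^esub> h \<otimes>\<^bsub>G\<^esub> g)) \<circ> (\<lambda>m. k \<otimes>\<^bsub>G\<^esub> m)) m"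
              by simp
          qed simp
        qed
        also have "\<dots> = (\<Sum>h\<in>S. b (inv\<^bsub>G\<^esub> k \<otimes>\<^bsub>G\<^esub> h) * c (inv\<^bsub>G\<^esub> h \<otimes>\<^bsub>G\<^esub> g))"
        proof (rule sum.mono_neutral_left)
          show "(\<lambda>m. k \<otimes>\<^bsub>G\<^esub> m) ` Sb \<subseteq> S"
            using k by (auto simp: S_def)
          show "\<forall>h\<in>S - (\<lambda>m. k \<otimes>\<^bsub>G\<^esub> m) ` Sb. b (inv\<^bsub>G\<^esub> k \<otimes>\<^bsub>G\<^esub> h) * c (inv\<^bsub>G\<^esub> h \<otimes>\<^bsub>G\<^esub> g) = 0"
          proof
            fix h assume h: "h \<in> S - (\<lambda>m. k \<otimes>\<^bsub>G\<^esub> m) ` Sb"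
            then have "h \<in> carrier G" using subS by auto
            then have "h = k \<otimes>\<^bsub>G\<^esub> (inv\<^bsub>G\<^esub> k \<otimes>\<^bsub>G\<^esub> h)"
              using kc by (simp add: m_assoc[symmetric])
            then have "inv\<^bsub>G\<^esub> k \<otimes>\<^bsub>G\<^esub> h \<notin> Sb" using h by blast
            then show "b (inv\<^bsub>G\<^esub> k \<otimes>\<^bsub>G\<^esub> h) * c (inv\<^bsub>G\<^esub> h \<otimes>\<^bsub>G\<^esub> g) = 0"
              by (simp add: Sb_def)
          qed
        qed (rule fin)
        finally show ?thesis by simp
      qed
      have "(a \<otimes>\<^bsub>?A\<^esub> b \<otimes>\<^bsub>?A\<^esub> c) g = (\<Sum>h\<in>S. (a \<otimes>\<^bsub>?A\<^esub> b) h * c (inv\<^bsub>G\<^esub> h \<otimes>\<^bsub>G\<^esub> g))"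
        by (rule group_algebra_mult_superset)
          (use fin g supp_mult[OF a, of b] in \<open>simp_all add: S_def Sa_def Sb_def\<close>)
      also have "\<dots> = (\<Sum>h\<in>S. (\<Sum>k\<in>Sa. a k * b (inv\<^bsub>G\<^esub> k \<otimes>\<^bsub>G\<^esub> h)) * c (inv\<^bsub>G\<^esub> h \<otimes>\<^bsub>G\<^esub> g))"
      proof (rule sum.cong)
        fix h assume "h \<in> S"
        then have "h \<in> carrier G" using subS by auto
        then have "(a \<otimes>\<^bsub>?A\<^esub> b) h = (\<Sum>k\<in>Sa. a k * b (inv\<^bsub>G\<^esub> k \<otimes>\<^bsub>G\<^esub> h))"
          by (intro group_algebra_mult_superset) (use fin in \<open>auto simp: Sa_def\<close>)
        then show "(a \<otimes>\<^bsub>?A\<^esub> b) h * c (inv\<^bsub>G\<^esub> h \<otimes>\<^bsub>G\<^esub> g) =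
            (\<Sum>k\<in>Sa. a k * b (inv\<^bsub>G\<^esub> k \<otimes>\<^bsub>G\<^esub> h)) * c (inv\<^bsub>G\<^esub> h \<otimes>\<^bsub>G\<^esub> g)"
          by simp
      qed simp
      also have "\<dots> = (\<Sum>k\<in>Sa. \<Sum>h\<in>S. a k * (b (inv\<^bsub>G\<^esub> k \<otimes>\<^bsub>G\<^esub> h) * c (inv\<^bsub>G\<^esub> h \<otimes>\<^bsub>G\<^esub> g)))"
        by (subst sum.swap) (simp add: sum_distrib_right mult.assoc)
      also have "\<dots> = (\<Sum>k\<in>Sa. a k * (b \<otimes>\<^bsub>?A\<^esub> c) (inv\<^bsub>G\<^esub> k \<otimes>\<^bsub>G\<^esub> g))"
        by (rule sum.cong) (simp_all add: inner sum_distrib_left[symmetric])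
      also have "\<dots> = (a \<otimes>\<^bsub>?A\<^esub> (b \<otimes>\<^bsub>?A\<^esub> c)) g"
        by (rule group_algebra_mult_superset[symmetric]) (use fin g in \<open>auto simp: Sa_def\<close>)
      finally show ?thesis .
    qed (simp add: outside)
  qed
  show ?thesis
  proof (rule ringI)
    show "abelian_group ?A"
    proof (rule abelian_groupI)
      fix a assume a: "a \<in> carrier ?A"
      show "\<exists>b\<in>carrier ?A. b \<oplus>\<^bsub>?A\<^esub> a = \<zero>\<^bsub>?A\<^esub>"
        by (rule bexI[of _ "\<lambda>g. - a g"]) (use a in \<open>auto simp: add zero car\<close>)
    qed (auto simp: add_closed, auto simp: add zero car algebra_simps)
    show "Group.monoid ?A"
    proof (rule monoidI)
      fix a assume a: "a \<in> carrier ?A"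
      show "\<one>\<^bsub>?A\<^esub> \<otimes>\<^bsub>?A\<^esub> a = a"
      proof
        fix g
        show "(\<one>\<^bsub>?A\<^esub> \<otimes>\<^bsub>?A\<^esub> a) g = a g"
        proof (cases "g \<in> carrier G")
          case True
          then have "(\<one>\<^bsub>?A\<^esub> \<otimes>\<^bsub>?A\<^esub> a) g = (\<Sum>h\<in>{\<one>\<^bsub>G\<^esub>}. \<one>\<^bsub>?A\<^esub> h * a (inv\<^bsub>G\<^esub> h \<otimes>\<^bsub>G\<^esub> g))"
            by (intro group_algebra_mult_superset) (auto simp: one split: if_splits)
          with True show ?thesis by (simp add: one)
        next
          case False
          then show ?thesis using a outside car by fastforce
        qed
      qed
      show "a \<otimes>\<^bsub>?A\<^esub> \<one>\<^bsub>?A\<^esub> = a"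
      proof
        fix g
        show "(a \<otimes>\<^bsub>?A\<^esub> \<one>\<^bsub>?A\<^esub>) g = a g"
        proof (cases "g \<in> carrier G")
          case g: True
          have "(a \<otimes>\<^bsub>?A\<^esub> \<one>\<^bsub>?A\<^esub>) g = (\<Sum>h\<in>insert g {h. a h \<noteq> 0}. a h * \<one>\<^bsub>?A\<^esub> (inv\<^bsub>G\<^esub> h \<otimes>\<^bsub>G\<^esub> g))"
            by (rule group_algebra_mult_superset) (use a g car in auto)
          also have "\<dots> = (\<Sum>h\<in>insert g {h. a h \<noteq> 0}. if h = g then a h else 0)"
          proof (rule sum.cong)
            fix h assume "h \<in> insert g {h. a h \<noteq> 0}"
            then have h: "h \<in> carrier G" using g a car by blast
            then have "inv\<^bsub>G\<^esub> h \<otimes>\<^bsub>G\<^esub> g = \<one>\<^bsub>G\<^esub> \<longleftrightarrow> h = g"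
              using g by (metis inv_solve_left l_inv r_one one_closed)
            then show "a h * \<one>\<^bsub>?A\<^esub> (inv\<^bsub>G\<^esub> h \<otimes>\<^bsub>G\<^esub> g) = (if h = g then a h else 0)"
              by (simp add: one)
          qed simp
          also have "\<dots> = a g"
            using a by (simp add: car sum.delta)
          finally show ?thesis .
        next
          case False
          then show ?thesis using a outside car by fastforce
        qed
      qed
    qed (auto simp: mult_closed assoc, auto simp: one car split: if_splits)
  next
    fix a b c assume abc: "a \<in> carrier ?A" "b \<in> carrier ?A" "c \<in> carrier ?A"
    show "(a \<oplus>\<^bsub>?A\<^esub> b) \<otimes>\<^bsub>?A\<^esub> c = a \<otimes>\<^bsub>?A\<^esub> c \<oplus>\<^bsub>?A\<^esub> b \<otimes>\<^bsub>?A\<^esub> c"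
    proof
      fix g
      let ?S = "{h. a h \<noteq> 0} \<union> {h. b h \<noteq> 0}"
      show "((a \<oplus>\<^bsub>?A\<^esub> b) \<otimes>\<^bsub>?A\<^esub> c) g = (a \<otimes>\<^bsub>?A\<^esub> c \<oplus>\<^bsub>?A\<^esub> b \<otimes>\<^bsub>?A\<^esub> c) g"
      proof (cases "g \<in> carrier G")
        case g: True
        have fin: "finite ?S" using abc car by auto
        have "((a \<oplus>\<^bsub>?A\<^esub> b) \<otimes>\<^bsub>?A\<^esub> c) g =
            (\<Sum>h\<in>?S. (a \<oplus>\<^bsub>?A\<^esub> b) h * c (inv\<^bsub>G\<^esub> h \<otimes>\<^bsub>G\<^esub> g))"
          by (rule group_algebra_mult_superset) (use fin g in \<open>auto simp: add\<close>)
        moreover have "(a \<otimes>\<^bsub>?A\<^esub> c) g = (\<Sum>h\<in>?S. a h * c (inv\<^bsub>G\<^esub> h \<otimes>\<^bsub>G\<^esub> g))"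
          by (rule group_algebra_mult_superset) (use fin g in auto)
        moreover have "(b \<otimes>\<^bsub>?A\<^esub> c) g = (\<Sum>h\<in>?S. b h * c (inv\<^bsub>G\<^esub> h \<otimes>\<^bsub>G\<^esub> g))"
          by (rule group_algebra_mult_superset) (use fin g in auto)
        ultimately show ?thesis
          by (simp add: add sum.distrib distrib_right)
      qed (simp add: outside add)
    qed
    show "c \<otimes>\<^bsub>?A\<^esub> (a \<oplus>\<^bsub>?A\<^esub> b) = c \<otimes>\<^bsub>?A\<^esub> a \<oplus>\<^bsub>?A\<^esub> c \<otimes>\<^bsub>?A\<^esub> b"
      by (rule ext) (simp add: group_algebra_def sum.distrib distrib_left)
  qed
qed

definition ga_elem :: "'g \<Rightarrow> 'g \<Rightarrow> 'a::comm_ring_1" where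
  "ga_elem g = (\<lambda>h. if h = g then 1 else 0)"

definition ga_poly :: "('g, 'm) monoid_scheme \<Rightarrow> 'g \<Rightarrow> 'a::comm_ring_1 poly \<Rightarrow> 'g \<Rightarrow> 'a" where
  "ga_poly G g p = (\<lambda>h. \<Sum>i\<le>Polynomial.degree p. Polynomial.coeff p i * ga_elem (g [^]\<^bsub>G\<^esub> i) h)"

section \<open>Idempotents\<close>

definition ring_idempotent :: "('r, 'm) ring_scheme \<Rightarrow> 'r \<Rightarrow> bool" where
  "ring_idempotent R e \<longleftrightarrow> e \<in> carrier R \<and> e \<otimes>\<^bsub>R\<^esub> e = e"

definition ring_central :: "('r, 'm) ring_scheme \<Rightarrow> 'r \<Rightarrow> bool" where
  "ring_central R e \<longleftrightarrow> e \<in> carrier R \<and> (\<forall>r\<in>carrier R. e \<otimes>\<^bsub>R\<^esub> r = r \<otimes>\<^bsub>R\<^esub> e)"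

definition primitive_idempotent :: "('r, 'm) ring_scheme \<Rightarrow> 'r \<Rightarrow> bool" where
  "primitive_idempotent R e \<longleftrightarrow> ring_idempotent R e \<and> e \<noteq> \<zero>\<^bsub>R\<^esub> \<and>
     \<not> (\<exists>u v. ring_idempotent R u \<and> ring_idempotent R v \<and> u \<noteq> \<zero>\<^bsub>R\<^esub> \<and> v \<noteq> \<zero>\<^bsub>R\<^esub> \<and>
          u \<otimes>\<^bsub>R\<^esub> v = \<zero>\<^bsub>R\<^esub> \<and> v \<otimes>\<^bsub>R\<^esub> u = \<zero>\<^bsub>R\<^esub> \<and> e = u \<oplus>\<^bsub>R\<^esub> v)"

section \<open>Polynomials\<close>

text \<open>The reciprocal \<open>x ^ m * p (1 / x)\<close> of a polynomial of degree at most \<open>m\<close>;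
  \<^const>\<open>reflect_poly\<close> is the case where \<open>m\<close> is the exact degree.\<close>

definition reciprocal_deg :: "nat \<Rightarrow> 'a::comm_ring_1 poly \<Rightarrow> 'a poly" where
  "reciprocal_deg m p = (\<Sum>i\<le>m. Polynomial.monom (Polynomial.coeff p i) (m - i))"

definition poly_ord :: "'a::field poly \<Rightarrow> nat" where
  "poly_ord g = (LEAST N. N \<ge> 1 \<and> g dvd (Polynomial.monom 1 N - 1))"

text \<open>The roots \<open>a\<^sub>1, \<dots>, a\<^sub>k\<close> of \<open>g\<close> are taken with multiplicity in an algebraic closure.\<close>

definition star_s :: "nat \<Rightarrow> 'a::field poly \<Rightarrow> 'a alg_closure poly" where
  "star_s s g = (\<Prod>a\<in>#proots (map_poly to_ac g). [:- (a ^ s), 1:])"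

text \<open>The first three conjuncts are the conditions under which the notion applies to \<open>g\<close>; they hold
  automatically for monic divisors of \<open>x ^ n - 1\<close> when \<open>n \<ge> 1\<close> and \<open>s\<^sup>2\<close> is congruent to \<open>1\<close> modulo \<open>n\<close>.\<close>

definition s_self_involutive :: "nat \<Rightarrow> 'a::field poly \<Rightarrow> bool" where
  "s_self_involutive s g \<longleftrightarrow>
     Polynomial.lead_coeff g = 1 \<and> poly g 0 \<noteq> 0 \<and> [s\<^sup>2 = 1] (mod poly_ord g) \<and>
     {z. poly (map_poly to_ac g) z = 0} = {z. poly (star_s s g) z = 0}"

section \<open>The elements \<open>e\<^sub>f\<^sub>,\<^sub>1\<close> and \<open>e\<^sub>f\<^sub>,\<^sub>2\<close>\<close>

definition e_f1 :: "nat \<Rightarrow> nat \<Rightarrow> 'a::field poly \<Rightarrow> 'a poly \<Rightarrow> gen gword set \<Rightarrow> 'a" where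
  "e_f1 n s f l =
     (let G = split_group n s;
          A = group_algebra G;
          P = ga_poly G (split_x n s);
          y = ga_elem (split_y n s);
          h = reciprocal_deg (Polynomial.degree f - 1) (pderiv (reflect_poly f))
      in P (smult (- (1 / of_nat n)) h) \<otimes>\<^bsub>A\<^esub> P ((Polynomial.monom 1 n - 1) div f)
           \<otimes>\<^bsub>A\<^esub> (P l \<otimes>\<^bsub>A\<^esub> (\<one>\<^bsub>A\<^esub> \<ominus>\<^bsub>A\<^esub> y) \<oplus>\<^bsub>A\<^esub> \<one>\<^bsub>A\<^esub>))"

definition e_f2 :: "nat \<Rightarrow> nat \<Rightarrow> 'a::field poly \<Rightarrow> 'a poly \<Rightarrow> gen gword set \<Rightarrow> 'a" where
  "e_f2 n s f l =
     (let G = split_group n s;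
          A = group_algebra G;
          P = ga_poly G (split_x n s);
          y = ga_elem (split_y n s);
          h = reciprocal_deg (Polynomial.degree f - 1) (pderiv (reflect_poly f))
      in P (smult (1 / of_nat n) h) \<otimes>\<^bsub>A\<^esub> P ((Polynomial.monom 1 n - 1) div f)
           \<otimes>\<^bsub>A\<^esub> (P l \<otimes>\<^bsub>A\<^esub> (\<one>\<^bsub>A\<^esub> \<ominus>\<^bsub>A\<^esub> y)))"

end

theory Submission
  imports Defs "HOL-Analysis.Determinants"
begin

text \<open>Let \<open>\<alpha>\<close> be a root of \<open>f\<close> in the algebraic closure. Since \<open>f\<close> is \<open>s\<close>-self-involutive, \<open>\<alpha>\<^sup>s\<close> is a root
  as well, and \<open>x \<mapsto> diag(\<alpha>, \<alpha>\<^sup>s)\<close>, \<open>y \<mapsto> (0 1; 1 0)\<close> defines a representation \<open>\<rho>\<close> of the group algebra by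
  \<open>2 \<times> 2\<close> matrices. Put \<open>\<theta> = -(1/n) ((f\<^sup>*)')\<^sup>* (x\<^sup>n - 1)/f\<close>. Writing elements as \<open>a(x) + b(x) y\<close>, vanishing of
  \<open>\<rho>\<close> forces \<open>f\<close> to divide \<open>a\<close> and \<open>b\<close>, so \<open>\<rho>\<close> is injective on the right ideal generated by the idempotent
  \<open>\<theta>\<close>. This ideal contains both \<open>e\<^sub>f\<^sub>,\<^sub>1\<close> and \<open>e\<^sub>f\<^sub>,\<^sub>2\<close>. From \<open>l(\<alpha>) + l(\<alpha>\<^sup>s) = -1\<close> their images have determinant 0
  and trace 1, that is, they are rank-one idempotents, which are primitive even among all matrices;
  and their images do not commute with \<open>\<rho>(x)\<close>, because an off-diagonal entry is nonzero and \<open>\<alpha> \<noteq> \<alpha>\<^sup>s\<close>.\<close>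

no_notation fps_nth (infixl \<open>$\<close> 75)

section \<open>Rank-one idempotents\<close>

text \<open>Over the fraction field a singular \<open>E\<close> is a column times a row,
  \<open>c r\<close>, so \<open>E U E = c (r U c) r\<close>, and the scalar \<open>r U c\<close> is
  the trace of \<open>U E\<close>. The proof stays in the domain and checks the four entries from
  the single relation \<open>d\<close>.\<close>

lemma rank_one_sandwich:
  fixes E U :: "'b::idom^2^2"
  assumes "det E = 0"
  shows "(E ** U ** E) $ i $ j = trace (U ** E) * E $ i $ j"
proof -
  have d: "E$1$1 * E$2$2 = E$1$2 * E$2$1"
    using assms by (simp add: det_2)
  have "\<forall>i j. (E ** U ** E) $ i $ j = trace (U ** E) * E $ i $ j"
    unfolding forall_2 matrix_matrix_mult_def trace_def
    by (simp add: sum_2, intro conjI) (use d in \<open>Groebner_Basis.algebra\<close>)+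
  then show ?thesis by blast
qed

lemma rank_one_idempotent:
  fixes E :: "'b::idom^2^2"
  assumes "det E = 0" "trace E = 1"
  shows "E ** E = E"
  using rank_one_sandwich[of E "mat 1"] assms by (simp add: vec_eq_iff)

text \<open>By the sandwich formula every product \<open>E U E\<close> is a multiple
  \<open>t E\<close>. Comparing traces in \<open>U = U U\<close> gives \<open>t = t t\<close>, and
  in a domain only 0 and 1 satisfy this.\<close>

lemma idempotent_below_rank_one:
  fixes E U :: "'b::idom^2^2"
  assumes E: "det E = 0" "trace E = 1"
    and U: "E ** U = U" "U ** E = U" "U ** U = U"
  shows "U = 0 \<or> U = E"
proof -
  define t where "t = trace (U ** E)"
  have "E ** U ** E = U"
    unfolding U(1,2) ..
  then have Ut: "U $ i $ j = t * E $ i $ j" for i j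
    using rank_one_sandwich[OF E(1), of U i j] by (simp add: t_def)
  have "t = trace (E ** U)"
    unfolding t_def by (rule trace_mul_sym)
  also have "\<dots> = trace (U ** U)"
    unfolding U(1,3) ..
  also have "\<dots> = (\<Sum>i\<in>UNIV. \<Sum>k\<in>UNIV. t * t * (E $ i $ k * E $ k $ i))"
    unfolding trace_def matrix_matrix_mult_def by (simp add: Ut mult_ac)
  also have "\<dots> = t * t * trace (E ** E)"
    by (simp add: trace_def matrix_matrix_mult_def sum_distrib_left)
  also have "\<dots> = t * t"
    using rank_one_idempotent[OF E] E by simp
  finally have "t = 0 \<or> t = 1"
    by simp
  then show ?thesis
    using Ut by (auto simp: vec_eq_iff)
qed

text \<open>Primitivity is transferred along a map \<rho> whose kernel is annihilated by left
  multiplication with \<theta>: elements fixed by \<theta> are then determined by their images. Both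
  \<open>e\<close> and its orthogonal summands are fixed, and the image of a summand can only be 0
  or \<open>\<rho> e\<close>.\<close>

lemma primitive_idempotent_if_rank_one:
  fixes A (structure) and \<rho> :: "'r \<Rightarrow> 'b::idom^2^2"
  assumes "ring A"
    and add: "\<And>u v. u \<in> carrier A \<Longrightarrow> v \<in> carrier A \<Longrightarrow> \<rho> (u \<oplus> v) = \<rho> u + \<rho> v"
    and mult: "\<And>u v. u \<in> carrier A \<Longrightarrow> v \<in> carrier A \<Longrightarrow> \<rho> (u \<otimes> v) = \<rho> u ** \<rho> v"
    and \<theta>: "\<theta> \<in> carrier A"
    and inj: "\<And>u. u \<in> carrier A \<Longrightarrow> \<rho> u = 0 \<Longrightarrow> \<theta> \<otimes> u = \<zero>"
    and e: "e \<in> carrier A" "\<theta> \<otimes> e = e"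
    and rank: "det (\<rho> e) = 0" "trace (\<rho> e) = 1"
  shows "primitive_idempotent A e"
proof -
  interpret ring A by fact
  have zero: "\<rho> \<zero> = 0"
    using add[of \<zero> \<zero>] by simp
  have minus: "\<rho> (u \<ominus> v) = \<rho> u - \<rho> v" if "u \<in> carrier A" "v \<in> carrier A" for u v
  proof -
    have "(u \<ominus> v) \<oplus> v = u"
      using that by algebra
    then show ?thesis
      using add[of "u \<ominus> v" v] that by (simp add: algebra_simps)
  qed
  have inj2: "\<theta> \<otimes> u = \<theta> \<otimes> v" if "u \<in> carrier A" "v \<in> carrier A" "\<rho> u = \<rho> v" for u v
  proof -
    have "\<theta> \<otimes> (u \<ominus> v) = \<zero>"
      using that minus by (intro inj) auto
    then have "\<theta> \<otimes> u \<ominus> \<theta> \<otimes> v = \<zero>"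
      using that \<theta> by (simp add: a_minus_def r_distr r_minus)
    then show ?thesis
      using that \<theta> by (simp add: r_right_minus_eq)
  qed
  have "\<rho> (e \<otimes> e) = \<rho> e"
    using mult e rank_one_idempotent[OF rank] by simp
  then have "\<theta> \<otimes> (e \<otimes> e) = \<theta> \<otimes> e"
    using e by (intro inj2) auto
  then have idem: "e \<otimes> e = e"
    using e \<theta> by (simp add: m_assoc[symmetric])
  have "e \<noteq> \<zero>"
    using zero rank by (auto simp: trace_0[unfolded mat_0])
  moreover have False
    if uv: "u \<in> carrier A" "u \<otimes> u = u" "v \<in> carrier A" "v \<otimes> v = v"
      "u \<noteq> \<zero>" "v \<noteq> \<zero>" "u \<otimes> v = \<zero>" "v \<otimes> u = \<zero>" "e = u \<oplus> v" for u v
  proof -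
    \<comment> \<open>Orthogonality makes \<open>e\<close> a left identity of both summands, so
      \<theta>, which fixes \<open>e\<close>, fixes them too; \<open>inj\<close> can then decide
      whether they vanish.\<close>
    have eu: "e \<otimes> u = u" "u \<otimes> e = u" and ev: "e \<otimes> v = v"
      using uv by (simp_all add: l_distr r_distr)
    have tu: "\<theta> \<otimes> u = u"
      using m_assoc[OF \<theta> e(1) uv(1)] e(2) eu by simp
    have tv: "\<theta> \<otimes> v = v"
      using m_assoc[OF \<theta> e(1) uv(3)] e(2) ev by simp
    have "\<rho> u = 0 \<or> \<rho> u = \<rho> e"
      using rank mult[of e u] mult[of u e] mult[of u u] eu uv e
      by (intro idempotent_below_rank_one) auto
    moreover have "\<rho> e = \<rho> u + \<rho> v"
      using add uv by simp
    ultimately have "\<rho> u = 0 \<or> \<rho> v = 0"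
      by auto
    then show False
      using inj[of u] inj[of v] tu tv uv by auto
  qed
  ultimately show ?thesis
    using idem e unfolding primitive_idempotent_def ring_idempotent_def by blast
qed

section \<open>Matrix representations of group algebras\<close>

lemma group_algebra_simps [simp]:
  "a \<oplus>\<^bsub>group_algebra G\<^esub> b = (\<lambda>g. a g + b g)"
  "\<zero>\<^bsub>group_algebra G\<^esub> = (\<lambda>g. 0)"
  "\<one>\<^bsub>group_algebra G\<^esub> = ga_elem \<one>\<^bsub>G\<^esub>"
  by (auto simp: group_algebra_def ga_elem_def)

lemma group_algebra_outside:
  "a \<in> carrier (group_algebra G) \<Longrightarrow> g \<notin> carrier G \<Longrightarrow> a g = 0"
  unfolding group_algebra_def by auto

text \<open>The linear extension of \<open>R\<close> from the group to its algebra, with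
  coefficients embedded in the algebraic closure. Over an infinite carrier the sum defaults to 0, so
  the lemmas that evaluate it assume finiteness.\<close>

definition ga_matrix ::
  "('g, 'm) monoid_scheme \<Rightarrow> ('g \<Rightarrow> 'a::field alg_closure^'k^'k) \<Rightarrow> ('g \<Rightarrow> 'a) \<Rightarrow> 'a alg_closure^'k^'k"
  where "ga_matrix G R u = (\<chi> i j. \<Sum>g\<in>carrier G. to_ac (u g) * R g $ i $ j)"

lemma ga_matrix_add:
  "ga_matrix G R (u \<oplus>\<^bsub>group_algebra G\<^esub> v) = ga_matrix G R u + ga_matrix G R v"
  by (simp add: ga_matrix_def vec_eq_iff sum.distrib distrib_right)

lemma ga_matrix_scaled_elem:
  assumes "finite (carrier G)" "g \<in> carrier G"
  shows "ga_matrix G R (\<lambda>h. c * ga_elem g h) = (\<chi> i j. to_ac c * R g $ i $ j)"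
proof -
  have "(\<Sum>h\<in>carrier G. to_ac (c * ga_elem g h) * R h $ i $ j) = to_ac c * R g $ i $ j" for i j
  proof -
    have "(\<Sum>h\<in>carrier G. to_ac (c * ga_elem g h) * R h $ i $ j) =
        (\<Sum>h\<in>carrier G. if h = g then to_ac c * R g $ i $ j else 0)"
      by (intro sum.cong) (auto simp: ga_elem_def)
    then show ?thesis
      using assms by (simp add: sum.delta)
  qed
  then show ?thesis
    by (simp add: ga_matrix_def)
qed

lemma ga_matrix_elem:
  assumes "finite (carrier G)" "g \<in> carrier G"
  shows "ga_matrix G R (ga_elem g) = R g"
  using ga_matrix_scaled_elem[OF assms, of R 1] by (simp add: vec_eq_iff)

text \<open>In the convolution, substituting \<open>h g\<close> for \<open>g\<close> turns each term
  into \<open>u h * v g * R (h g)\<close>; multiplicativity of \<open>R\<close> then separates the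
  two sums.\<close>

lemma ga_matrix_mult:
  fixes G :: "('g, 'm) monoid_scheme"
  assumes "group G" and fin: "finite (carrier G)"
    and R: "\<And>g h. g \<in> carrier G \<Longrightarrow> h \<in> carrier G \<Longrightarrow> R (g \<otimes>\<^bsub>G\<^esub> h) = R g ** R h"
    and u: "u \<in> carrier (group_algebra G)"
  shows "ga_matrix G R (u \<otimes>\<^bsub>group_algebra G\<^esub> v) = ga_matrix G R u ** ga_matrix G R v"
proof -
  interpret group G by fact
  have supp: "{h. u h \<noteq> 0} \<subseteq> carrier G"
    using group_algebra_outside[OF u] by auto
  have "(\<Sum>g\<in>carrier G. to_ac ((u \<otimes>\<^bsub>group_algebra G\<^esub> v) g) * R g $ i $ j) =
      (\<Sum>k\<in>UNIV. (\<Sum>g\<in>carrier G. to_ac (u g) * R g $ i $ k) *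
        (\<Sum>h\<in>carrier G. to_ac (v h) * R h $ k $ j))" for i j
  proof -
    have "(\<Sum>g\<in>carrier G. to_ac ((u \<otimes>\<^bsub>group_algebra G\<^esub> v) g) * R g $ i $ j) =
        (\<Sum>g\<in>carrier G. \<Sum>h\<in>carrier G.
          to_ac (u h) * to_ac (v (inv\<^bsub>G\<^esub> h \<otimes>\<^bsub>G\<^esub> g)) * R g $ i $ j)"
      by (rule sum.cong) (simp_all add: group_algebra_mult_superset[OF fin supp]
          to_ac_sum sum_distrib_right)
    also have "\<dots> = (\<Sum>h\<in>carrier G. \<Sum>g\<in>carrier G.
          to_ac (u h) * to_ac (v (inv\<^bsub>G\<^esub> h \<otimes>\<^bsub>G\<^esub> g)) * R g $ i $ j)"
      by (rule sum.swap)
    also have "\<dots> = (\<Sum>h\<in>carrier G. \<Sum>g\<in>carrier G.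
          to_ac (u h) * to_ac (v g) * R (h \<otimes>\<^bsub>G\<^esub> g) $ i $ j)"
    proof (rule sum.cong)
      fix h assume h: "h \<in> carrier G"
      show "(\<Sum>g\<in>carrier G. to_ac (u h) * to_ac (v (inv\<^bsub>G\<^esub> h \<otimes>\<^bsub>G\<^esub> g)) * R g $ i $ j) =
          (\<Sum>g\<in>carrier G. to_ac (u h) * to_ac (v g) * R (h \<otimes>\<^bsub>G\<^esub> g) $ i $ j)"
        by (rule sum.reindex_bij_witness[of _ "\<lambda>g. h \<otimes>\<^bsub>G\<^esub> g" "\<lambda>g. inv\<^bsub>G\<^esub> h \<otimes>\<^bsub>G\<^esub> g"])
          (use h in \<open>auto simp: m_assoc[symmetric]\<close>)
    qed simp
    also have "\<dots> = (\<Sum>h\<in>carrier G. \<Sum>g\<in>carrier G. \<Sum>k\<in>UNIV.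
          (to_ac (u h) * R h $ i $ k) * (to_ac (v g) * R g $ k $ j))"
      by (intro sum.cong HOL.refl)
        (simp_all add: R matrix_matrix_mult_def sum_distrib_left mult_ac)
    also have "\<dots> = (\<Sum>h\<in>carrier G. \<Sum>k\<in>UNIV. \<Sum>g\<in>carrier G.
          (to_ac (u h) * R h $ i $ k) * (to_ac (v g) * R g $ k $ j))"
      by (rule sum.cong[OF HOL.refl]) (rule sum.swap)
    also have "\<dots> = (\<Sum>k\<in>UNIV. \<Sum>h\<in>carrier G. \<Sum>g\<in>carrier G.
          (to_ac (u h) * R h $ i $ k) * (to_ac (v g) * R g $ k $ j))"
      by (rule sum.swap)
    finally show ?thesis
      by (simp add: sum_product)
  qed
  then show ?thesis
    by (simp add: ga_matrix_def matrix_matrix_mult_def vec_eq_iff)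
qed

section \<open>Polynomials in a group element\<close>

text \<open>A common upper bound on the degrees lets different polynomials be compared term by
  term.\<close>

lemma ga_poly_upto:
  assumes "Polynomial.degree p \<le> m"
  shows "ga_poly G g p h = (\<Sum>i\<le>m. Polynomial.coeff p i * ga_elem (g [^]\<^bsub>G\<^esub> i) h)"
  unfolding ga_poly_def
  by (rule sum.mono_neutral_left) (use assms in \<open>auto simp: coeff_eq_0\<close>)

lemma ga_poly_add: "ga_poly G g (p + q) = (\<lambda>h. ga_poly G g p h + ga_poly G g q h)"
proof
  fix h
  let ?m = "max (Polynomial.degree p) (Polynomial.degree q)"
  have "Polynomial.degree (p + q) \<le> ?m"
    by (rule degree_add_le) auto
  then show "ga_poly G g (p + q) h = ga_poly G g p h + ga_poly G g q h"
    using ga_poly_upto[of p ?m G g h] ga_poly_upto[of q ?m G g h] ga_poly_upto[of "p + q" ?m G g h]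
    by (simp add: sum.distrib distrib_right)
qed

lemma ga_poly_smult: "ga_poly G g (Polynomial.smult c p) = (\<lambda>h. c * ga_poly G g p h)"
proof
  fix h
  show "ga_poly G g (Polynomial.smult c p) h = c * ga_poly G g p h"
    using ga_poly_upto[of "Polynomial.smult c p" "Polynomial.degree p" G g h] degree_smult_le[of c p]
    by (simp add: ga_poly_def sum_distrib_left mult_ac)
qed

lemma ga_poly_0 [simp]: "ga_poly G g 0 = (\<lambda>h. 0)"
  by (auto simp: ga_poly_def)

lemma ga_poly_monom: "ga_poly G g (Polynomial.monom c k) = (\<lambda>h. c * ga_elem (g [^]\<^bsub>G\<^esub> k) h)"
proof
  fix h
  have "ga_poly G g (Polynomial.monom c k) h =
      (\<Sum>i\<le>k. if i = k then c * ga_elem (g [^]\<^bsub>G\<^esub> k) h else 0)"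
    using ga_poly_upto[of "Polynomial.monom c k" k G g h] degree_monom_le[of c k]
    by (simp add: if_distrib[of "\<lambda>x. x * _"] cong: if_cong sum.cong)
  then show "ga_poly G g (Polynomial.monom c k) h = c * ga_elem (g [^]\<^bsub>G\<^esub> k) h"
    by simp
qed

lemma ga_elem_mult:
  assumes "h \<in> carrier G"
  shows "ga_elem h \<otimes>\<^bsub>group_algebra G\<^esub> u = (\<lambda>g. if g \<in> carrier G then u (inv\<^bsub>G\<^esub> h \<otimes>\<^bsub>G\<^esub> g) else 0)"
proof
  fix g
  show "(ga_elem h \<otimes>\<^bsub>group_algebra G\<^esub> u) g = (if g \<in> carrier G then u (inv\<^bsub>G\<^esub> h \<otimes>\<^bsub>G\<^esub> g) else 0)"
  proof (cases "g \<in> carrier G")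
    case True
    have "(ga_elem h \<otimes>\<^bsub>group_algebra G\<^esub> u) g = (\<Sum>k\<in>{h}. ga_elem h k * u (inv\<^bsub>G\<^esub> k \<otimes>\<^bsub>G\<^esub> g))"
      using True by (intro group_algebra_mult_superset) (auto simp: ga_elem_def)
    then show ?thesis
      using True by (simp add: ga_elem_def)
  qed (simp add: group_algebra_def)
qed

lemma (in group) ga_elem_mult_elem:
  assumes "g \<in> carrier G" "h \<in> carrier G"
  shows "ga_elem g \<otimes>\<^bsub>group_algebra G\<^esub> ga_elem h = ga_elem (g \<otimes> h)"
  unfolding ga_elem_mult[OF assms(1)] using assms
  by (auto simp: ga_elem_def fun_eq_iff inv_solve_left' m_assoc[symmetric])

lemma group_algebra_smult_mult:
  "(\<lambda>g. c * u g) \<otimes>\<^bsub>group_algebra G\<^esub> v = (\<lambda>g. (c::'a::field) * (u \<otimes>\<^bsub>group_algebra G\<^esub> v) g)"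
  \<comment> \<open>The product sums over the support of the left factor, which scaling changes only
    for \<open>c = 0\<close>.\<close>
  by (cases "c = 0") (auto simp: group_algebra_def sum_distrib_left mult.assoc)

lemma (in group) ga_poly_closed:
  assumes "g \<in> carrier G"
  shows "ga_poly G g p \<in> carrier (group_algebra G)"
proof -
  have "{h. ga_poly G g p h \<noteq> 0} \<subseteq> (\<lambda>i. g [^] i) ` {..Polynomial.degree p}"
  proof
    fix h assume "h \<in> {h. ga_poly G g p h \<noteq> 0}"
    then obtain i where "i \<le> Polynomial.degree p" "Polynomial.coeff p i * ga_elem (g [^] i) h \<noteq> 0"
      unfolding ga_poly_def by (force elim: sum.not_neutral_contains_not_neutral)
    then show "h \<in> (\<lambda>i. g [^] i) ` {..Polynomial.degree p}"
      by (auto simp: ga_elem_def split: if_splits)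
  qed
  then show ?thesis
    using assms unfolding group_algebra_def
    by (auto intro: finite_subset)
qed

lemma (in group) ga_elem_closed:
  "g \<in> carrier G \<Longrightarrow> ga_elem g \<in> carrier (group_algebra G)"
  by (auto simp: group_algebra_def ga_elem_def)

text \<open>One step of Horner's scheme; it drives the inductions that show multiplicativity of
  \<open>ga_poly\<close> and compute its image under the representation.\<close>

lemma (in group) ga_poly_pCons:
  fixes p :: "'f::comm_ring_1 poly"
  assumes g: "g \<in> carrier G"
  shows "ga_poly G g (pCons c p) =
    (\<lambda>h. c * ga_elem \<one> h) \<oplus>\<^bsub>group_algebra G\<^esub> (ga_elem g \<otimes>\<^bsub>group_algebra G\<^esub> ga_poly G g p)"
proof
  fix h
  have "ga_elem (g [^] Suc i) h = (if h \<in> carrier G then ga_elem (g [^] i) (inv g \<otimes> h) else (0::'f))" for i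
    using g nat_pow_Suc2[of g i] inv_solve_left[of "g [^] i" g h]
    by (auto simp: ga_elem_def m_assoc[symmetric] simp del: nat_pow_Suc)
  then show "ga_poly G g (pCons c p) h =
    ((\<lambda>h. c * ga_elem \<one> h) \<oplus>\<^bsub>group_algebra G\<^esub> (ga_elem g \<otimes>\<^bsub>group_algebra G\<^esub> ga_poly G g p)) h"
    using g
    by (subst ga_poly_upto[of _ "Suc (Polynomial.degree p)"])
      (simp_all add: degree_pCons_le sum.atMost_Suc_shift ga_elem_mult ga_poly_def
        del: nat_pow_Suc sum.atMost_Suc)
qed

lemma (in group) ga_poly_mult:
  fixes p q :: "'f::field poly"
  assumes g: "g \<in> carrier G"
  shows "ga_poly G g (p * q) = ga_poly G g p \<otimes>\<^bsub>group_algebra G\<^esub> ga_poly G g q"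
proof (induction p)
  case 0
  show ?case by (simp add: group_algebra_def fun_eq_iff)
next
  case (pCons c p)
  let ?A = "group_algebra G :: ('a \<Rightarrow> 'f) ring"
  interpret A: ring ?A
    by (rule ring_group_algebra) (rule is_group)
  note cl = ga_poly_closed[OF g] ga_elem_closed[OF g] ga_elem_closed[OF one_closed]
  have sc: "(\<lambda>h. c * ga_elem \<one> h) \<in> carrier ?A"
    by (auto simp: group_algebra_def ga_elem_def)
  have q1: "ga_elem \<one> \<otimes>\<^bsub>?A\<^esub> ga_poly G g q = ga_poly G g q"
    using A.l_one[OF ga_poly_closed[OF g, of q]] by simp
  have "ga_poly G g (pCons c p * q) = (\<lambda>h. c * ga_poly G g q h) \<oplus>\<^bsub>?A\<^esub> ga_poly G g (pCons 0 (p * q))"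
    by (simp add: ga_poly_add ga_poly_smult)
  also have "ga_poly G g (pCons 0 (p * q)) = ga_elem g \<otimes>\<^bsub>?A\<^esub> (ga_poly G g p \<otimes>\<^bsub>?A\<^esub> ga_poly G g q)"
    using ga_poly_pCons[OF g, of 0 "p * q"] pCons.IH by simp
  also have "\<dots> = (ga_elem g \<otimes>\<^bsub>?A\<^esub> ga_poly G g p) \<otimes>\<^bsub>?A\<^esub> ga_poly G g q"
    by (rule A.m_assoc[symmetric]) (rule cl)+
  also have "(\<lambda>h. c * ga_poly G g q h) = (\<lambda>h. c * ga_elem \<one> h) \<otimes>\<^bsub>?A\<^esub> ga_poly G g q"
    by (simp add: group_algebra_smult_mult q1)
  also have "((\<lambda>h. c * ga_elem \<one> h) \<otimes>\<^bsub>?A\<^esub> ga_poly G g q) \<oplus>\<^bsub>?A\<^esub>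
      (ga_elem g \<otimes>\<^bsub>?A\<^esub> ga_poly G g p) \<otimes>\<^bsub>?A\<^esub> ga_poly G g q =
      ga_poly G g (pCons c p) \<otimes>\<^bsub>?A\<^esub> ga_poly G g q"
    unfolding ga_poly_pCons[OF g, of c p]
    by (rule A.l_distr[symmetric]) (intro sc cl A.m_closed)+
  finally show ?case .
qed

section \<open>Matrix representations of presented groups\<close>

definition word_matrix :: "('c \<times> bool \<Rightarrow> 'b::comm_ring_1^'k^'k) \<Rightarrow> 'c gword \<Rightarrow> 'b^'k^'k" where
  "word_matrix M w = foldr (\<lambda>c. (**) (M c)) w (mat 1)"

lemma word_matrix_simps [simp]:
  "word_matrix M [] = mat 1"
  "word_matrix M (c # w) = M c ** word_matrix M w"
  by (simp_all add: word_matrix_def)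

lemma word_matrix_append: "word_matrix M (u @ v) = word_matrix M u ** word_matrix M v"
  by (induction u) (simp_all add: matrix_mul_assoc)

text \<open>A class is evaluated at an arbitrary representative; \<open>pres_matrix_class\<close>
  shows the choice to be immaterial once \<open>M\<close> respects the relations and sends formal
  inverses to inverses.\<close>

definition pres_matrix :: "('c \<times> bool \<Rightarrow> 'b::comm_ring_1^'k^'k) \<Rightarrow> 'c gword set \<Rightarrow> 'b^'k^'k" where
  "pres_matrix M C = word_matrix M (SOME w. w \<in> C)"

text \<open>The universal property of the presentation: every closure rule of \<open>pres_eq\<close>
  preserves the value of a word.\<close>

lemma word_matrix_pres_eq:
  assumes "pres_eq R u v"
    and rel: "\<And>u v. (u, v) \<in> R \<Longrightarrow> word_matrix M u = word_matrix M v"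
    and inv: "\<And>a b. M (a, b) ** M (a, \<not> b) = mat 1"
  shows "word_matrix M u = word_matrix M v"
  using assms(1) by induction (simp_all add: rel inv word_matrix_append)

lemma pres_matrix_class:
  assumes rel: "\<And>u v. (u, v) \<in> R \<Longrightarrow> word_matrix M u = word_matrix M v"
    and inv: "\<And>a b. M (a, b) ** M (a, \<not> b) = mat 1"
  shows "pres_matrix M (pres_class R w) = word_matrix M w"
proof -
  have "w \<in> pres_class R w"
    by (simp add: pres_class_def pres_eq.refl)
  then have "(SOME v. v \<in> pres_class R w) \<in> pres_class R w"
    by (rule someI)
  then have "pres_eq R w (SOME v. v \<in> pres_class R w)"
    by (simp add: pres_class_def)
  from word_matrix_pres_eq[OF this rel inv] show ?thesis
    by (simp add: pres_matrix_def)
qed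

lemma pres_matrix_mult:
  assumes rel: "\<And>u v. (u, v) \<in> R \<Longrightarrow> word_matrix M u = word_matrix M v"
    and inv: "\<And>a b. M (a, b) ** M (a, \<not> b) = mat 1"
    and "g \<in> carrier (presented_group R)" "h \<in> carrier (presented_group R)"
  shows "pres_matrix M (g \<otimes>\<^bsub>presented_group R\<^esub> h) = pres_matrix M g ** pres_matrix M h"
proof -
  obtain u v where "g = pres_class R u" "h = pres_class R v"
    using assms(3,4) by (auto simp: presented_group_def)
  then show ?thesis
    by (simp add: presented_group_mult pres_matrix_class[OF rel inv] word_matrix_append)
qed

section \<open>The group \<open>split_group n s\<close>\<close>

lemma group_split_group: "group (split_group n s)"
  unfolding split_group_def by (rule group_presented_group)

lemma split_gens_closed:
  "split_x n s \<in> carrier (split_group n s)" "split_y n s \<in> carrier (split_group n s)"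
  by (simp_all add: split_x_def split_y_def split_group_def presented_group_def)

lemma split_x_pow:
  "split_x n s [^]\<^bsub>split_group n s\<^esub> k =
    pres_class (split_relations n s) (replicate k (Gen_x, True))"
proof (induction k)
  case 0
  show ?case by (simp add: split_group_def presented_group_def nat_pow_def)
next
  case (Suc k)
  interpret group "split_group n s" by (rule group_split_group)
  show ?case
    using Suc
    by (simp add: split_x_def split_group_def presented_group_mult replicate_append_same)
qed

lemma split_relations:
  fixes n s :: nat
  defines "G \<equiv> split_group n s" and "x \<equiv> split_x n s" and "y \<equiv> split_y n s"
  shows "x [^]\<^bsub>G\<^esub> n = \<one>\<^bsub>G\<^esub>" "y \<otimes>\<^bsub>G\<^esub> y = \<one>\<^bsub>G\<^esub>" "x \<otimes>\<^bsub>G\<^esub> y = y \<otimes>\<^bsub>G\<^esub> x [^]\<^bsub>G\<^esub> s"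
proof -
  have one: "\<one>\<^bsub>G\<^esub> = pres_class (split_relations n s) []"
    by (simp add: G_def split_group_def presented_group_def)
  show "x [^]\<^bsub>G\<^esub> n = \<one>\<^bsub>G\<^esub>"
    unfolding one unfolding G_def x_def split_x_pow pres_class_eq_iff
    by (rule pres_eq.rel) (simp add: split_relations_def Let_def)
  show "y \<otimes>\<^bsub>G\<^esub> y = \<one>\<^bsub>G\<^esub>"
    unfolding one unfolding G_def y_def split_y_def split_group_def presented_group_mult pres_class_eq_iff
    by (rule pres_eq.rel) (simp add: split_relations_def Let_def)
  show "x \<otimes>\<^bsub>G\<^esub> y = y \<otimes>\<^bsub>G\<^esub> x [^]\<^bsub>G\<^esub> s"
    unfolding G_def x_def y_def split_x_pow
    unfolding split_x_def split_y_def split_group_def presented_group_mult pres_class_eq_iff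
    by (rule pres_eq.rel) (simp add: split_relations_def Let_def)
qed

lemma split_y_x_pow:
  fixes n s :: nat
  defines "G \<equiv> split_group n s" and "x \<equiv> split_x n s" and "y \<equiv> split_y n s"
  shows "y \<otimes>\<^bsub>G\<^esub> x [^]\<^bsub>G\<^esub> k = x [^]\<^bsub>G\<^esub> (s * k) \<otimes>\<^bsub>G\<^esub> y"
proof -
  interpret group G unfolding G_def by (rule group_split_group)
  note [simp] = split_gens_closed[of n s, folded G_def x_def y_def]
  note rels = split_relations[of n s, folded G_def x_def y_def]
  \<comment> \<open>As \<open>y\<close> is an involution, inserting \<open>y y\<close> turns the
    relation \<open>x y = y x^s\<close> into \<open>y x = x^s y\<close>.\<close>
  have "y \<otimes>\<^bsub>G\<^esub> x = y \<otimes>\<^bsub>G\<^esub> (x \<otimes>\<^bsub>G\<^esub> y) \<otimes>\<^bsub>G\<^esub> y"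
    using rels(2) by (simp add: m_assoc)
  also have "\<dots> = (y \<otimes>\<^bsub>G\<^esub> y) \<otimes>\<^bsub>G\<^esub> x [^]\<^bsub>G\<^esub> s \<otimes>\<^bsub>G\<^esub> y"
    by (simp add: rels(3) m_assoc)
  finally have yx: "y \<otimes>\<^bsub>G\<^esub> x = x [^]\<^bsub>G\<^esub> s \<otimes>\<^bsub>G\<^esub> y"
    by (simp add: rels(2))
  show ?thesis
  proof (induction k)
    case 0
    show ?case by simp
  next
    case (Suc k)
    have "y \<otimes>\<^bsub>G\<^esub> x [^]\<^bsub>G\<^esub> Suc k = (y \<otimes>\<^bsub>G\<^esub> x [^]\<^bsub>G\<^esub> k) \<otimes>\<^bsub>G\<^esub> x"
      by (simp add: m_assoc)
    also have "\<dots> = x [^]\<^bsub>G\<^esub> (s * k) \<otimes>\<^bsub>G\<^esub> (y \<otimes>\<^bsub>G\<^esub> x)"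
      by (simp add: Suc m_assoc)
    also have "\<dots> = x [^]\<^bsub>G\<^esub> (s * k) \<otimes>\<^bsub>G\<^esub> x [^]\<^bsub>G\<^esub> s \<otimes>\<^bsub>G\<^esub> y"
      by (simp add: yx m_assoc)
    also have "\<dots> = x [^]\<^bsub>G\<^esub> (s * Suc k) \<otimes>\<^bsub>G\<^esub> y"
      by (simp add: nat_pow_mult add.commute)
    finally show ?case .
  qed
qed

text \<open>A normal form, reached by moving every \<open>y\<close> to the right. Only existence is
  claimed; vanishing in the algebra is later decided by the matrix representation.\<close>

lemma split_group_elements:
  fixes n s :: nat
  defines "G \<equiv> split_group n s" and "x \<equiv> split_x n s" and "y \<equiv> split_y n s"
  assumes n: "n > 0" and g: "g \<in> carrier G"
  obtains i where "i < n" "g = x [^]\<^bsub>G\<^esub> i \<or> g = x [^]\<^bsub>G\<^esub> i \<otimes>\<^bsub>G\<^esub> y"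
proof -
  interpret group G unfolding G_def by (rule group_split_group)
  note [simp] = split_gens_closed[of n s, folded G_def x_def y_def]
  note rels = split_relations[of n s, folded G_def x_def y_def]
  note y_x = split_y_x_pow[of n s, folded G_def x_def y_def]
  let ?cl = "pres_class (split_relations n s)"
  \<comment> \<open>The exponent stays unrestricted during the induction over words and is reduced
    modulo \<open>n\<close> only at the end.\<close>
  let ?P = "\<lambda>g. \<exists>i. g = x [^]\<^bsub>G\<^esub> (i::nat) \<or> g = x [^]\<^bsub>G\<^esub> i \<otimes>\<^bsub>G\<^esub> y"
  have x_step: "?P (x [^]\<^bsub>G\<^esub> (k::nat) \<otimes>\<^bsub>G\<^esub> g)" if g: "?P g" for k g
  proof -
    obtain i where i: "g = x [^]\<^bsub>G\<^esub> (i::nat) \<or> g = x [^]\<^bsub>G\<^esub> i \<otimes>\<^bsub>G\<^esub> y"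
      using g by blast
    then have "x [^]\<^bsub>G\<^esub> k \<otimes>\<^bsub>G\<^esub> g = x [^]\<^bsub>G\<^esub> (k + i) \<or> x [^]\<^bsub>G\<^esub> k \<otimes>\<^bsub>G\<^esub> g = x [^]\<^bsub>G\<^esub> (k + i) \<otimes>\<^bsub>G\<^esub> y"
      by (auto simp: nat_pow_mult[symmetric] m_assoc)
    then show ?thesis by blast
  qed
  have y_step: "?P (y \<otimes>\<^bsub>G\<^esub> g)" if g: "?P g" for g
  proof -
    obtain i where i: "g = x [^]\<^bsub>G\<^esub> (i::nat) \<or> g = x [^]\<^bsub>G\<^esub> i \<otimes>\<^bsub>G\<^esub> y"
      using g by blast
    have "y \<otimes>\<^bsub>G\<^esub> (x [^]\<^bsub>G\<^esub> i \<otimes>\<^bsub>G\<^esub> y) = (y \<otimes>\<^bsub>G\<^esub> x [^]\<^bsub>G\<^esub> i) \<otimes>\<^bsub>G\<^esub> y"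
      by (simp add: m_assoc)
    also have "\<dots> = x [^]\<^bsub>G\<^esub> (s * i) \<otimes>\<^bsub>G\<^esub> (y \<otimes>\<^bsub>G\<^esub> y)"
      by (simp only: y_x) (simp add: m_assoc)
    also have "\<dots> = x [^]\<^bsub>G\<^esub> (s * i)"
      by (simp add: rels(2))
    finally show ?thesis
      using i y_x[of i] by metis
  qed
  have cl_Cons: "?cl (c # w) = ?cl [c] \<otimes>\<^bsub>G\<^esub> ?cl w" for c w
    by (simp add: G_def split_group_def presented_group_mult)
  have cl_closed: "?cl w \<in> carrier G" for w
    by (simp add: G_def split_group_def presented_group_def)
  have one: "?cl [] = \<one>\<^bsub>G\<^esub>"
    by (simp add: G_def split_group_def presented_group_def)
  have cl_inv: "?cl [(a, False)] = inv\<^bsub>G\<^esub> (?cl [(a, True)])" for a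
  proof -
    have "?cl [(a, False), (a, True)] = \<one>\<^bsub>G\<^esub>"
      using pres_eq.cancel[of "split_relations n s" a False] by (simp add: one[symmetric] pres_class_eq_iff)
    then show ?thesis
      using cl_Cons[of "(a, False)" "[(a, True)]"] cl_closed by (simp add: inv_equality)
  qed
  have letter: "?cl [c] = y \<or> (\<exists>k. ?cl [c] = x [^]\<^bsub>G\<^esub> (k::nat))" for c
  proof -
    have x1: "?cl [(Gen_x, True)] = x" and y1: "?cl [(Gen_y, True)] = y"
      by (simp_all add: x_def y_def split_x_def split_y_def)
    have "inv\<^bsub>G\<^esub> y = y"
      using rels(2) by (simp add: inv_equality)
    \<comment> \<open>Since \<open>n > 0\<close>, the inverse of \<open>x\<close> is itself a
      nonnegative power, so formal inverses obey the same two step rules as the generators.\<close>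
    moreover have "x [^]\<^bsub>G\<^esub> (n - 1) \<otimes>\<^bsub>G\<^esub> x = \<one>\<^bsub>G\<^esub>"
      using rels(1) n nat_pow_Suc[of x "n - 1"] by simp
    then have "inv\<^bsub>G\<^esub> x = x [^]\<^bsub>G\<^esub> (n - 1)"
      by (simp add: inv_equality)
    moreover have "x = x [^]\<^bsub>G\<^esub> (1::nat)"
      by simp
    moreover obtain a b where "c = (a, b)" by force
    ultimately show ?thesis
      using x1 y1 cl_inv[of a] by (cases a; cases b) metis+
  qed
  have P: "?P (?cl w)" for w
  proof (induction w)
    case Nil
    show ?case by (rule exI[of _ 0]) (simp add: one)
  next
    case (Cons c w)
    show ?case
      using letter[of c] x_step[OF Cons] y_step[OF Cons] unfolding cl_Cons[of c w] by auto
  qed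
  obtain w where "g = ?cl w"
    using g by (auto simp: G_def split_group_def presented_group_def)
  then obtain i where i: "g = x [^]\<^bsub>G\<^esub> (i::nat) \<or> g = x [^]\<^bsub>G\<^esub> i \<otimes>\<^bsub>G\<^esub> y"
    using P by blast
  have "x [^]\<^bsub>G\<^esub> i = x [^]\<^bsub>G\<^esub> (n * (i div n)) \<otimes>\<^bsub>G\<^esub> x [^]\<^bsub>G\<^esub> (i mod n)"
    by (simp add: nat_pow_mult)
  also have "\<dots> = x [^]\<^bsub>G\<^esub> (i mod n)"
    by (simp add: nat_pow_pow[symmetric] rels(1))
  finally show thesis
    using that[of "i mod n"] i n by simp
qed

lemma finite_split_group:
  assumes "n > 0"
  shows "finite (carrier (split_group n s))"
proof (rule finite_subset)
  let ?G = "split_group n s"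
  let ?x = "split_x n s"
  show "carrier ?G \<subseteq> (\<lambda>i. ?x [^]\<^bsub>?G\<^esub> i) ` {..<n} \<union>
      (\<lambda>i. ?x [^]\<^bsub>?G\<^esub> i \<otimes>\<^bsub>?G\<^esub> split_y n s) ` {..<n}"
    by (rule subsetI) (erule split_group_elements[OF assms], auto)
qed simp

text \<open>The normal form gives every scaled group element this shape, and the shape is closed
  under sums. Induction over a finite set containing the support adds the terms up.\<close>

lemma split_algebra_elements:
  fixes n s :: nat and u :: "gen gword set \<Rightarrow> 'a::field"
  defines "G \<equiv> split_group n s" and "x \<equiv> split_x n s" and "y \<equiv> split_y n s"
  defines "A \<equiv> group_algebra G :: (gen gword set \<Rightarrow> 'a) ring"
  assumes n: "n > 0" and u: "u \<in> carrier A"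
  shows "\<exists>a b. u = ga_poly G x a \<oplus>\<^bsub>A\<^esub> (ga_poly G x b \<otimes>\<^bsub>A\<^esub> ga_elem y)"
proof -
  interpret group G unfolding G_def by (rule group_split_group)
  interpret A: ring A unfolding A_def by (rule ring_group_algebra) (rule is_group)
  note [simp] = split_gens_closed[of n s, folded G_def x_def y_def]
  have [simp]: "ga_poly G x p \<in> carrier A" "g \<in> carrier G \<Longrightarrow> ga_elem g \<in> carrier A" for p g
    by (simp_all add: A_def ga_poly_closed ga_elem_closed)
  let ?P = "\<lambda>u. \<exists>a b. u = ga_poly G x a \<oplus>\<^bsub>A\<^esub> (ga_poly G x b \<otimes>\<^bsub>A\<^esub> ga_elem y)"
  have add: "?P (u \<oplus>\<^bsub>A\<^esub> v)" if u: "?P u" and v: "?P v" for u v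
  proof -
    obtain a b where u: "u = ga_poly G x a \<oplus>\<^bsub>A\<^esub> (ga_poly G x b \<otimes>\<^bsub>A\<^esub> ga_elem y)"
      using u by blast
    obtain c d where v: "v = ga_poly G x c \<oplus>\<^bsub>A\<^esub> (ga_poly G x d \<otimes>\<^bsub>A\<^esub> ga_elem y)"
      using v by blast
    have P_add: "ga_poly G x (p + q) = ga_poly G x p \<oplus>\<^bsub>A\<^esub> ga_poly G x q" for p q
      by (simp add: A_def ga_poly_add)
    have "u \<oplus>\<^bsub>A\<^esub> v = ga_poly G x (a + c) \<oplus>\<^bsub>A\<^esub> (ga_poly G x (b + d) \<otimes>\<^bsub>A\<^esub> ga_elem y)"
      unfolding u v P_add by (simp add: A.l_distr A.a_ac)
    then show ?thesis by blast
  qed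
  have P0: "ga_poly G x 0 = \<zero>\<^bsub>A\<^esub>"
    by (simp add: A_def)
  have elem: "?P (\<lambda>h. c * ga_elem g h)" if g: "g \<in> carrier G" for g c
  proof -
    obtain i where i: "g = x [^]\<^bsub>G\<^esub> (i::nat) \<or> g = x [^]\<^bsub>G\<^esub> i \<otimes>\<^bsub>G\<^esub> y"
      using split_group_elements[of n g s, folded G_def x_def y_def] n g by blast
    have c_closed: "(\<lambda>h. c * ga_elem (x [^]\<^bsub>G\<^esub> i) h) \<in> carrier A"
      unfolding ga_poly_monom[symmetric] by simp
    have "(\<lambda>h. c * ga_elem (x [^]\<^bsub>G\<^esub> i) h) = ga_poly G x (Polynomial.monom c i) \<oplus>\<^bsub>A\<^esub> (ga_poly G x 0 \<otimes>\<^bsub>A\<^esub> ga_elem y)"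
      unfolding P0 ga_poly_monom by (simp add: A_def[symmetric] c_closed)
    moreover have "(\<lambda>h. c * ga_elem (x [^]\<^bsub>G\<^esub> i \<otimes>\<^bsub>G\<^esub> y) h) =
        ga_poly G x 0 \<oplus>\<^bsub>A\<^esub> (ga_poly G x (Polynomial.monom c i) \<otimes>\<^bsub>A\<^esub> ga_elem y)"
      by (simp add: ga_poly_monom A_def group_algebra_smult_mult ga_elem_mult_elem)
    ultimately show ?thesis
      using i by blast
  qed
  have "?P u" if "finite S" "S \<subseteq> carrier G" "\<And>g. g \<notin> S \<Longrightarrow> u g = 0" for S u
    using that
  proof (induction S arbitrary: u)
    case empty
    then have "u = \<zero>\<^bsub>A\<^esub>"
      by (simp add: A_def fun_eq_iff)
    then have "u = ga_poly G x 0 \<oplus>\<^bsub>A\<^esub> (ga_poly G x 0 \<otimes>\<^bsub>A\<^esub> ga_elem y)"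
      unfolding P0 by simp
    then show ?case by blast
  next
    case (insert g S)
    have "?P (u(g := 0))"
      using insert.prems by (intro insert.IH) auto
    moreover have "u = (\<lambda>h. u g * ga_elem g h) \<oplus>\<^bsub>A\<^esub> (u(g := 0))"
      by (auto simp: A_def ga_elem_def)
    ultimately show ?case
      using add[OF elem[of g "u g"]] insert.prems(1) by (metis insert_subset)
  qed
  from this[of "carrier G" u] show ?thesis
    using finite_split_group[OF n, of s] group_algebra_outside[of u G] u
    by (simp add: G_def A_def)
qed

section \<open>Evaluation at roots in the algebraic closure\<close>

definition ac_eval :: "'a::field alg_closure \<Rightarrow> 'a poly \<Rightarrow> 'a alg_closure" where
  "ac_eval z p = poly (map_poly to_ac p) z"

lemma ac_eval_simps [simp]:
  "ac_eval z 0 = 0"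
  "ac_eval z 1 = 1"
  "ac_eval z (pCons c p) = to_ac c + z * ac_eval z p"
  "ac_eval z (Polynomial.monom c k) = to_ac c * z ^ k"
  by (simp_all add: ac_eval_def map_poly_pCons map_poly_monom poly_monom)

lemma ac_eval_add [simp]: "ac_eval z (p + q) = ac_eval z p + ac_eval z q"
proof -
  have "map_poly to_ac (p + q) = map_poly to_ac p + map_poly to_ac q"
    by (rule poly_eqI) (simp add: coeff_map_poly)
  then show ?thesis by (simp add: ac_eval_def)
qed

lemma ac_eval_smult [simp]: "ac_eval z (Polynomial.smult c p) = to_ac c * ac_eval z p"
  by (simp add: ac_eval_def map_poly_smult)

lemma ac_eval_mult [simp]: "ac_eval z (p * q) = ac_eval z p * ac_eval z q"
  by (induction p) (simp_all add: algebra_simps)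

lemma ac_eval_minus [simp]: "ac_eval z (- p) = - ac_eval z p"
  using ac_eval_smult[of z "- 1" p] by simp

lemma ac_eval_diff [simp]: "ac_eval z (p - q) = ac_eval z p - ac_eval z q"
  using ac_eval_add[of z p "- q"] by simp

lemma ac_eval_root_if_dvd: "f dvd p \<Longrightarrow> ac_eval z f = 0 \<Longrightarrow> ac_eval z p = 0"
  by (auto elim: dvdE)

text \<open>Let \<open>m\<close> have least degree among the nonzero polynomials vanishing at
  \<open>z\<close>. Division with remainder shows that \<open>m\<close> divides all of them; in
  particular \<open>m\<close> divides \<open>f\<close> and is no unit, so irreducibility makes
  \<open>f\<close> divide \<open>m\<close> in turn.\<close>

lemma irreducible_dvd_if_root:
  fixes f p :: "'a::field poly"
  assumes f: "Factorial_Ring.irreducible f" and root: "ac_eval z f = 0" "ac_eval z p = 0"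
  shows "f dvd p"
proof -
  define Q where "Q = (\<lambda>m. m \<noteq> 0 \<and> ac_eval z m = 0)"
  have "f \<noteq> 0" using f by auto
  then have "Q f" using root by (simp add: Q_def)
  then obtain m where m: "Q m" and min: "\<And>m'. Q m' \<Longrightarrow> Polynomial.degree m \<le> Polynomial.degree m'"
    using ex_has_least_nat[of Q f Polynomial.degree] by blast
  have dvd: "m dvd a" if "ac_eval z a = 0" for a
  proof (rule ccontr)
    assume "\<not> m dvd a"
    then have nz: "a mod m \<noteq> 0" by (simp add: dvd_eq_mod_eq_0)
    have "a mod m = a - a div m * m"
      by (simp add: minus_div_mult_eq_mod)
    then have "ac_eval z (a mod m) = 0"
      using m that by (simp add: Q_def)
    then have "Polynomial.degree m \<le> Polynomial.degree (a mod m)"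
      using nz min by (simp add: Q_def)
    then show False
      using degree_mod_less[of m a] m nz by (simp add: Q_def)
  qed
  have "\<not> m dvd 1"
    using ac_eval_root_if_dvd[of m 1 z] m by (auto simp: Q_def)
  then have "f dvd m"
    using f dvd[OF root(1)] irreducibleD' by blast
  then show ?thesis
    using dvd[OF root(2)] dvd_trans by blast
qed

lemma irreducible_has_root:
  fixes f :: "'a::field poly"
  assumes "Factorial_Ring.irreducible f"
  obtains z where "ac_eval z f = 0"
proof -
  have "Polynomial.degree f \<noteq> 0"
    using assms by (metis Factorial_Ring.irreducible_def is_unit_iff_degree)
  then have "Polynomial.degree (map_poly to_ac f) > 0"
    by (simp add: degree_map_poly)
  then show thesis
    using alg_closed_imp_poly_has_root that by (auto simp: ac_eval_def)
qed

text \<open>By construction \<open>z ^ s\<close> is a root of \<open>star_s s f\<close>, whose root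
  set is that of \<open>f\<close>.\<close>

lemma s_self_involutive_root_power:
  assumes "s_self_involutive s f" "ac_eval z f = 0"
  shows "ac_eval (z ^ s) f = 0"
proof -
  have nz: "map_poly to_ac f \<noteq> 0"
    using assms(1) by (auto simp: s_self_involutive_def map_poly_eq_0_iff)
  then have "z \<in># proots (map_poly to_ac f)"
    using assms(2) by (simp add: ac_eval_def)
  then have "poly (star_s s f) (z ^ s) = 0"
    by (auto simp: star_s_def poly_prod_mset prod_mset_zero_iff intro!: image_eqI[of _ _ z])
  then show ?thesis
    using assms(1) by (auto simp: s_self_involutive_def ac_eval_def)
qed

section \<open>The idempotent of \<open>f\<close>\<close>

text \<open>With \<open>m\<close> the degree, reversal moves the coefficient at \<open>k\<close> to
  \<open>m - k\<close>, the derivative multiplies it by \<open>m - k\<close> and moves it to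
  \<open>m - k - 1\<close>, and reversal with respect to \<open>m - 1\<close> brings it back to
  \<open>k\<close>.\<close>

lemma reciprocal_pderiv_reciprocal:
  "reciprocal_deg (Polynomial.degree f - 1) (pderiv (reflect_poly f)) =
    of_nat (Polynomial.degree f) * f - pCons 0 (pderiv f)"
proof (rule poly_eqI)
  fix k
  let ?m = "Polynomial.degree f"
  have "Polynomial.coeff (reciprocal_deg (?m - 1) (pderiv (reflect_poly f))) k =
      (\<Sum>i\<le>?m - 1. if i = ?m - 1 - k \<and> k \<le> ?m - 1 then Polynomial.coeff (pderiv (reflect_poly f)) i else 0)"
    unfolding reciprocal_deg_def coeff_sum by (intro sum.cong) auto
  also have "\<dots> = (if k \<le> ?m - 1 then Polynomial.coeff (pderiv (reflect_poly f)) (?m - 1 - k) else 0)"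
    by (auto simp: sum.delta)
  also have "\<dots> = (of_nat ?m - of_nat k) * Polynomial.coeff f k"
  proof (cases "k < ?m")
    case True
    then have "?m - Suc (?m - 1 - k) = k" "Suc (?m - 1 - k) = ?m - k" "k \<le> ?m - 1" "\<not> ?m < ?m - k"
      by auto
    with True show ?thesis
      by (simp add: coeff_pderiv coeff_reflect_poly of_nat_diff)
  next
    case False
    show ?thesis
    proof (cases "k = ?m")
      case True
      \<comment> \<open>Here the factor \<open>m - k\<close> vanishes. The case \<open>m = 0\<close>
        is separate, because the truncated \<open>m - 1\<close> then still admits
        \<open>k = 0\<close>.\<close>
      then show ?thesis
        by (cases ?m) (simp_all add: coeff_pderiv coeff_reflect_poly)
    next
      case neq: False
      then show ?thesis
        using False by (simp add: coeff_eq_0)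
    qed
  qed
  also have "\<dots> = Polynomial.coeff (of_nat ?m * f - pCons 0 (pderiv f)) k"
    by (cases k) (simp_all add: coeff_pderiv of_nat_poly algebra_simps coeff_pCons)
  finally show "Polynomial.coeff (reciprocal_deg (?m - 1) (pderiv (reflect_poly f))) k =
      Polynomial.coeff (of_nat ?m * f - pCons 0 (pderiv f)) k" .
qed

text \<open>At a root of \<open>f\<close> the double reciprocal takes the value
  \<open>- z f'(z)\<close>. Differentiating \<open>f g = x^n - 1\<close> there gives
  \<open>f'(z) g(z) = n z^(n - 1)\<close>, so the product is \<open>z^n = 1\<close>.\<close>

lemma ac_eval_idempotent_poly:
  fixes f :: "'a::field poly"
  assumes n: "(of_nat n :: 'a) \<noteq> 0" "n > 0"
    and fg: "f * g = Polynomial.monom 1 n - 1"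
    and root: "ac_eval z f = 0"
  shows "ac_eval z (Polynomial.smult (- (1 / of_nat n))
    (reciprocal_deg (Polynomial.degree f - 1) (pderiv (reflect_poly f))) * g) = 1"
proof -
  have zn: "z ^ n = 1"
    using root arg_cong[OF fg, of "ac_eval z"] by simp
  have "ac_eval z (pderiv (f * g)) = ac_eval z g * ac_eval z (pderiv f)"
    using root by (simp add: pderiv_mult)
  moreover have "pderiv (f * g) = Polynomial.monom (of_nat n) (n - 1)"
    unfolding fg by (simp add: pderiv_diff pderiv_monom)
  ultimately have "z * (ac_eval z g * ac_eval z (pderiv f)) = z * (of_nat n * z ^ (n - 1))"
    by simp
  also have "\<dots> = of_nat n"
    using zn n(2) by (simp add: mult_ac power_eq_if[of z n] split: if_splits)
  finally have *: "z * (ac_eval z g * ac_eval z (pderiv f)) = of_nat n" .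
  have nz: "(of_nat n :: 'a alg_closure) \<noteq> 0"
    using n(1) by (metis to_ac_eq_0_iff to_ac_of_nat)
  show ?thesis
    unfolding reciprocal_pderiv_reciprocal using * nz root by (simp add: field_simps)
qed

section \<open>The two-dimensional representation attached to a root of \<open>f\<close>\<close>

definition diag2 :: "'b::comm_ring_1 \<Rightarrow> 'b \<Rightarrow> 'b^2^2" where
  "diag2 a b = vector [vector [a, 0], vector [0, b]]"

definition swap2 :: "'b::comm_ring_1^2^2" where
  "swap2 = vector [vector [0, 1], vector [1, 0]]"

lemma matrix2_entries [simp]:
  fixes a b :: "'b::comm_ring_1"
  shows "diag2 a b $ 1 $ 1 = a" "diag2 a b $ 1 $ 2 = 0" "diag2 a b $ 2 $ 1 = 0" "diag2 a b $ 2 $ 2 = b"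
  "swap2 $ 1 $ 1 = (0::'b)" "swap2 $ 1 $ 2 = (1::'b)" "swap2 $ 2 $ 1 = (1::'b)"
  "swap2 $ 2 $ 2 = (0::'b)"
  by (simp_all add: diag2_def swap2_def vector_2)

lemma matrix2_eq_iff:
  "(M :: 'b^2^2) = N \<longleftrightarrow> M$1$1 = N$1$1 \<and> M$1$2 = N$1$2 \<and> M$2$1 = N$2$1 \<and> M$2$2 = N$2$2"
  by (auto simp: vec_eq_iff forall_2)

lemma matrix2_mult_entry: "((M :: 'b::comm_ring_1^2^2) ** N) $ i $ j = M$i$1 * N$1$j + M$i$2 * N$2$j"
  by (simp add: matrix_matrix_mult_def sum_2)

lemma mat2_entries [simp]:
  "(mat 1 :: 'b::comm_ring_1^2^2) $ 1 $ 1 = 1" "(mat 1 :: 'b^2^2) $ 1 $ 2 = 0"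
  "(mat 1 :: 'b^2^2) $ 2 $ 1 = 0" "(mat 1 :: 'b^2^2) $ 2 $ 2 = 1"
  by (simp_all add: mat_def)

text \<open>The representation induced from the character of the cyclic subgroup of \<open>x\<close>
  that sends \<open>x\<close> to \<open>z\<close>. The image of \<open>y\<close> is an involution
  and thus serves both of its letters.\<close>

fun gen_matrix :: "nat \<Rightarrow> 'b::field \<Rightarrow> gen \<times> bool \<Rightarrow> 'b^2^2" where
  "gen_matrix s z (Gen_x, True) = diag2 z (z ^ s)"
| "gen_matrix s z (Gen_x, False) = diag2 (inverse z) (inverse (z ^ s))"
| "gen_matrix s z (Gen_y, b) = swap2"

lemma word_matrix_replicate_x:
  "word_matrix (gen_matrix s z) (replicate k (Gen_x, True)) = diag2 (z ^ k) ((z ^ s) ^ k)"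
  by (induction k) (simp_all add: matrix2_eq_iff matrix2_mult_entry)

lemma gen_matrix_inverse:
  assumes "z \<noteq> 0"
  shows "gen_matrix s z (a, b) ** gen_matrix s z (a, \<not> b) = mat 1"
  using assms by (cases a; cases b) (simp_all add: matrix2_eq_iff matrix2_mult_entry)

text \<open>The relation \<open>x y = y x^s\<close> compares \<open>z\<close> with
  \<open>z ^ (s * s)\<close> in the upper right entry; this is where the condition on
  \<open>s * s\<close> enters.\<close>

lemma gen_matrix_relations:
  assumes "z ^ n = 1" "z ^ (s * s) = z" "(u, v) \<in> split_relations n s"
  shows "word_matrix (gen_matrix s z) u = word_matrix (gen_matrix s z) v"
proof -
  have "(z ^ s) ^ n = 1"
    using assms(1) by (metis power_mult mult.commute power_one)
  then show ?thesis
    using assms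
    by (auto simp: split_relations_def Let_def word_matrix_replicate_x matrix2_eq_iff
        matrix2_mult_entry power_mult)
qed

definition split_rep :: "nat \<Rightarrow> nat \<Rightarrow> 'a::field alg_closure \<Rightarrow> (gen gword set \<Rightarrow> 'a) \<Rightarrow> 'a alg_closure^2^2"
  where "split_rep n s z = ga_matrix (split_group n s) (pres_matrix (gen_matrix s z))"

context
  fixes n s :: nat and z :: "'a::field alg_closure" and A G x y
  assumes n: "n > 0" and zn: "z ^ n = 1" and zs: "z ^ (s * s) = z"
  defines "G \<equiv> split_group n s" and "x \<equiv> split_x n s" and "y \<equiv> split_y n s"
    and "A \<equiv> group_algebra (split_group n s) :: (gen gword set \<Rightarrow> 'a) ring"
begin

interpretation group G
  unfolding G_def by (rule group_split_group)

interpretation A: ring A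
  unfolding A_def by (rule ring_group_algebra) (rule group_split_group)

lemma z_nonzero: "z \<noteq> 0"
  using n zn by (metis power_0_left not_gr_zero zero_neq_one)

lemmas gen_rels = gen_matrix_relations[OF zn zs] gen_matrix_inverse[OF z_nonzero]

lemma split_rep_add: "split_rep n s z (u \<oplus>\<^bsub>A\<^esub> v) = split_rep n s z u + split_rep n s z v"
  unfolding split_rep_def A_def by (rule ga_matrix_add)

lemma split_rep_mult:
  assumes "u \<in> carrier A"
  shows "split_rep n s z (u \<otimes>\<^bsub>A\<^esub> v) = split_rep n s z u ** split_rep n s z v"
  unfolding split_rep_def A_def
proof (rule ga_matrix_mult[OF group_split_group finite_split_group[OF n]])
  show "u \<in> carrier (group_algebra (split_group n s))"
    using assms by (simp add: A_def)
qed (unfold split_group_def, rule pres_matrix_mult[OF gen_rels])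

lemma split_rep_gens:
  "split_rep n s z (ga_elem x) = diag2 z (z ^ s)"
  "split_rep n s z (ga_elem y) = swap2"
  unfolding split_rep_def
  by (simp_all add: x_def y_def ga_matrix_elem[OF finite_split_group[OF n]] split_gens_closed)
    (simp_all add: split_x_def split_y_def pres_matrix_class[OF gen_rels])

lemma split_rep_scalar: "split_rep n s z (\<lambda>h. c * ga_elem \<one>\<^bsub>G\<^esub> h) = diag2 (to_ac c) (to_ac c)"
proof -
  have "\<one>\<^bsub>G\<^esub> = pres_class (split_relations n s) []"
    by (simp add: G_def split_group_def presented_group_def)
  then have "pres_matrix (gen_matrix s z) \<one>\<^bsub>G\<^esub> = mat 1"
    by (simp add: pres_matrix_class[OF gen_rels])
  then show ?thesis
    unfolding split_rep_def G_def
      ga_matrix_scaled_elem[OF finite_split_group[OF n, of s] one_closed[unfolded G_def]]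
    by (simp add: matrix2_eq_iff)
qed

lemma split_closed [simp]:
  "x \<in> carrier G" "y \<in> carrier G" "ga_elem x \<in> carrier A" "ga_elem y \<in> carrier A"
  "ga_poly G x p \<in> carrier A"
  using ga_elem_closed ga_poly_closed split_gens_closed[of n s]
  by (auto simp: A_def G_def x_def y_def)

lemma split_rep_poly: "split_rep n s z (ga_poly G x p) = diag2 (ac_eval z p) (ac_eval (z ^ s) p)"
proof (induction p)
  case 0
  show ?case
    by (simp add: split_rep_def ga_matrix_def matrix2_eq_iff)
next
  case (pCons c p)
  have "ga_poly G x (pCons c p) = (\<lambda>h. c * ga_elem \<one>\<^bsub>G\<^esub> h) \<oplus>\<^bsub>A\<^esub> (ga_elem x \<otimes>\<^bsub>A\<^esub> ga_poly G x p)"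
    using ga_poly_pCons[OF split_closed(1), of c p] by (simp add: A_def G_def)
  then show ?case
    by (simp only: split_rep_add split_rep_mult[OF split_closed(3)] split_rep_scalar split_rep_gens pCons.IH)
      (simp add: matrix2_eq_iff matrix2_mult_entry)
qed

lemma split_rep_one_minus_y: "split_rep n s z (\<one>\<^bsub>A\<^esub> \<ominus>\<^bsub>A\<^esub> ga_elem y) = mat 1 - swap2"
proof -
  \<comment> \<open>Adding \<open>y\<close> back reduces the difference to additivity of the
    representation.\<close>
  have "(\<one>\<^bsub>A\<^esub> \<ominus>\<^bsub>A\<^esub> ga_elem y) \<oplus>\<^bsub>A\<^esub> ga_elem y = \<one>\<^bsub>A\<^esub>"
    by (simp add: a_minus_def A.a_assoc A.l_neg)
  then have "split_rep n s z (\<one>\<^bsub>A\<^esub> \<ominus>\<^bsub>A\<^esub> ga_elem y) + swap2 = split_rep n s z \<one>\<^bsub>A\<^esub>"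
    using split_rep_add[of "\<one>\<^bsub>A\<^esub> \<ominus>\<^bsub>A\<^esub> ga_elem y" "ga_elem y"] split_rep_gens by simp
  moreover have "split_rep n s z \<one>\<^bsub>A\<^esub> = mat 1"
    using split_rep_scalar[of 1] by (simp add: A_def G_def matrix2_eq_iff)
  ultimately show ?thesis
    by (simp add: algebra_simps)
qed

section \<open>Polynomials in \<open>x\<close> modulo \<open>x^n - 1\<close>, and the right ideal of
  the idempotent\<close>

lemma split_poly_mult: "ga_poly G x (p * q) = ga_poly G x p \<otimes>\<^bsub>A\<^esub> ga_poly G x q"
  using ga_poly_mult[OF split_closed(1), of p q] by (simp add: A_def G_def)

lemma ga_poly_dvd_eq_zero:
  assumes "(Polynomial.monom 1 n - 1 :: 'a poly) dvd p"
  shows "ga_poly G x p = \<zero>\<^bsub>A\<^esub>"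
proof -
  obtain r where p: "p = r * (Polynomial.monom 1 n - 1)"
    using assms by (metis dvdE mult.commute)
  have "(Polynomial.monom 1 n - 1 :: 'a poly) = Polynomial.monom 1 n + Polynomial.monom (- 1) 0"
    by (simp add: monom_0 one_pCons)
  moreover have "ga_poly G x (Polynomial.monom 1 n + Polynomial.monom (- 1) 0 :: 'a poly) = \<zero>\<^bsub>A\<^esub>"
    using split_relations(1)[of n s]
    by (simp add: ga_poly_add ga_poly_monom A_def G_def x_def)
  ultimately have "ga_poly G x (Polynomial.monom 1 n - 1 :: 'a poly) = \<zero>\<^bsub>A\<^esub>"
    by (simp only:)
  then show ?thesis
    unfolding p split_poly_mult by simp
qed

lemma ga_poly_cong:
  assumes "(Polynomial.monom 1 n - 1 :: 'a poly) dvd p - q"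
  shows "ga_poly G x p = ga_poly G x q"
proof -
  have "ga_poly G x (q + (p - q)) = ga_poly G x q \<oplus>\<^bsub>A\<^esub> ga_poly G x (p - q)"
    unfolding A_def group_algebra_simps by (rule ga_poly_add)
  then show ?thesis
    using ga_poly_dvd_eq_zero[OF assms] by simp
qed

text \<open>For \<open>u = a(x) + b(x) y\<close> the first row of the image is
  \<open>a(z), b(z)\<close>, so \<open>f\<close> divides both polynomials. The factor
  \<open>g\<close> of \<open>T\<close> completes \<open>f\<close> to \<open>x^n - 1\<close>, which
  is zero in the algebra.\<close>

lemma split_rep_faithful_on_ideal:
  fixes f g T :: "'a poly"
  assumes f: "Factorial_Ring.irreducible f" "ac_eval z f = 0" "f * g = Polynomial.monom 1 n - 1"
    and T: "g dvd T"
    and u: "u \<in> carrier A" "split_rep n s z u = 0"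
  shows "ga_poly G x T \<otimes>\<^bsub>A\<^esub> u = \<zero>\<^bsub>A\<^esub>"
proof -
  obtain a b where ab: "u = ga_poly G x a \<oplus>\<^bsub>A\<^esub> (ga_poly G x b \<otimes>\<^bsub>A\<^esub> ga_elem y)"
    using split_algebra_elements[OF n, of u s] u(1) by (auto simp: A_def G_def x_def y_def)
  have "diag2 (ac_eval z a) (ac_eval (z ^ s) a) + diag2 (ac_eval z b) (ac_eval (z ^ s) b) ** swap2 = 0"
    using u(2) unfolding ab by (simp add: split_rep_add split_rep_mult split_rep_poly split_rep_gens)
  then have "ac_eval z a = 0" "ac_eval z b = 0"
    by (simp_all add: matrix2_eq_iff matrix2_mult_entry)
  then have "f dvd a" "f dvd b"
    using f irreducible_dvd_if_root by blast+
  then have "Polynomial.monom 1 n - 1 dvd T * a" "Polynomial.monom 1 n - 1 dvd T * b"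
    unfolding f(3)[symmetric] using T by (metis mult.commute mult_dvd_mono)+
  then have "ga_poly G x T \<otimes>\<^bsub>A\<^esub> ga_poly G x a = \<zero>\<^bsub>A\<^esub>" "ga_poly G x T \<otimes>\<^bsub>A\<^esub> ga_poly G x b = \<zero>\<^bsub>A\<^esub>"
    unfolding split_poly_mult[symmetric] by (blast intro: ga_poly_dvd_eq_zero)+
  then show ?thesis
    unfolding ab by (simp add: A.r_distr A.m_assoc[symmetric])
qed

text \<open>A common criterion for both elements, which differ in the scalar \<open>c\<close> and
  the factor \<open>w\<close>. The image of \<open>T\<close> in the algebra takes the role of
  \<theta>.\<close>

lemma split_rank_one_primitive_noncentral:
  fixes f g T :: "'a poly"
  assumes f: "Factorial_Ring.irreducible f" "ac_eval z f = 0" "f * g = Polynomial.monom 1 n - 1"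
    and T: "g dvd T" "ac_eval z T = 1"
    and e: "e = ga_poly G x (Polynomial.smult c T) \<otimes>\<^bsub>A\<^esub> w" and w: "w \<in> carrier A"
    and rank: "det (split_rep n s z e) = 0" "trace (split_rep n s z e) = 1"
    and off: "split_rep n s z e $ 1 $ 2 \<noteq> 0" "z ^ s \<noteq> z"
  shows "primitive_idempotent A e \<and> \<not> ring_central A e"
proof -
  have ec: "e \<in> carrier A"
    unfolding e using w by simp
  \<comment> \<open>As \<open>f\<close> divides \<open>T - 1\<close> and \<open>g\<close> divides
    \<open>T\<close>, the polynomial \<open>T\<close> is idempotent modulo \<open>x^n - 1\<close>;
    hence its image fixes \<open>e\<close> from the left.\<close>
  have "f dvd T - 1"
    using f T by (intro irreducible_dvd_if_root[of f z]) auto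
  then have "Polynomial.monom 1 n - 1 dvd (T - 1) * Polynomial.smult c T"
    unfolding f(3)[symmetric] using T(1) by (intro mult_dvd_mono dvd_smult)
  then have "ga_poly G x (T * Polynomial.smult c T) = ga_poly G x (Polynomial.smult c T)"
    by (intro ga_poly_cong) (simp add: algebra_simps smult_diff_right)
  then have Te: "ga_poly G x T \<otimes>\<^bsub>A\<^esub> e = e"
    unfolding e split_poly_mult using w by (simp add: A.m_assoc[symmetric])
  have "primitive_idempotent A e"
  proof (rule primitive_idempotent_if_rank_one[where \<rho> = "split_rep n s z"])
    show "ring A" by (rule A.ring_axioms)
    show "\<And>u. u \<in> carrier A \<Longrightarrow> split_rep n s z u = 0 \<Longrightarrow> ga_poly G x T \<otimes>\<^bsub>A\<^esub> u = \<zero>\<^bsub>A\<^esub>"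
      using split_rep_faithful_on_ideal[OF f T(1)] by blast
  qed (use split_rep_add split_rep_mult Te rank ec in auto)
  moreover have "\<not> ring_central A e"
  proof
    assume "ring_central A e"
    then have "e \<otimes>\<^bsub>A\<^esub> ga_elem x = ga_elem x \<otimes>\<^bsub>A\<^esub> e"
      by (simp add: ring_central_def)
    then have "split_rep n s z e ** diag2 z (z ^ s) = diag2 z (z ^ s) ** split_rep n s z e"
      using split_rep_mult[OF ec, of "ga_elem x"] split_rep_mult[of "ga_elem x" e] split_rep_gens by simp
    \<comment> \<open>In the upper right entry, commuting with the image of \<open>x\<close> would
      force \<open>z ^ s = z\<close>.\<close>
    then have "split_rep n s z e $ 1 $ 2 * z ^ s = z * split_rep n s z e $ 1 $ 2"
      by (simp add: matrix2_eq_iff matrix2_mult_entry)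
    then show False
      using off by (simp add: mult.commute)
  qed
  ultimately show ?thesis ..
qed

end

section \<open>The two elements and their images as rank-one matrices\<close>

theorem theorem6p1:
  fixes f l :: "'a::{field, finite} poly"
    and q n s d :: nat
  assumes "primepow q"
    and "CARD('a) = q"
    and "s > 0"
    and "[s\<^sup>2 = 1] (mod n)"
    and "gcd (2 * n) q = 1"
    and "d = gcd n (s - 1)"
    and "Polynomial.lead_coeff f = 1"
    and "Factorial_Ring.irreducible f"
    and "f dvd (Polynomial.monom 1 n - 1) div (Polynomial.monom 1 d - 1)"
    and "s_self_involutive s f"
    and "[(Polynomial.monom 1 (s - 1) - 1) * l = 1] (mod f)"
  shows "primitive_idempotent (group_algebra (split_group n s)) (e_f1 n s f l)
       \<and> \<not> ring_central (group_algebra (split_group n s)) (e_f1 n s f l)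
       \<and> primitive_idempotent (group_algebra (split_group n s)) (e_f2 n s f l)
       \<and> \<not> ring_central (group_algebra (split_group n s)) (e_f2 n s f l)"
proof -
  \<comment> \<open>For \<open>n = 0\<close> the coprimality would read \<open>q = 1\<close>, which
    no prime power satisfies.\<close>
  have n: "n > 0"
  proof (rule ccontr)
    assume "\<not> n > 0"
    then have "q = 1" using assms(5) by simp
    then show False using assms(1) by simp
  qed
  have n_field: "(of_nat n :: 'a) \<noteq> 0"
  proof
    assume "(of_nat n :: 'a) = 0"
    then have "CHAR('a) dvd 2 * n"
      by (simp add: of_nat_eq_0_iff_char_dvd)
    moreover have "CHAR('a) dvd q"
      using CHAR_dvd_CARD[where 'a = 'a] assms(2) by simp
    ultimately have "CHAR('a) dvd 1"
      using assms(5) by (metis gcd_greatest)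
    then show False by simp
  qed
  obtain z where root: "ac_eval z f = 0"
    using irreducible_has_root[OF assms(8)] .
  have root_s: "ac_eval (z ^ s) f = 0"
    by (rule s_self_involutive_root_power[OF assms(10) root])
  \<comment> \<open>This makes the quotient in the hypothesis on \<open>f\<close> exact, so
    \<open>f\<close> divides \<open>x^n - 1\<close> itself.\<close>
  have "(Polynomial.monom 1 d - 1 :: 'a poly) dvd Polynomial.monom 1 n - 1"
  proof -
    obtain k where "n = d * k"
      using assms(6) by (metis dvdE gcd_dvd1)
    then have "(Polynomial.monom 1 n - 1 :: 'a poly) = Polynomial.monom 1 d ^ k - 1 ^ k"
      by (simp add: monom_power)
    then show ?thesis
      using power_diff_sumr2[of "Polynomial.monom 1 d :: 'a poly" k 1] by simp
  qed
  then have f_dvd: "f dvd Polynomial.monom 1 n - 1"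
    using assms(9) by (metis dvd_mult dvd_mult_div_cancel)
  define g where "g = (Polynomial.monom 1 n - 1) div f"
  have fg: "f * g = Polynomial.monom 1 n - 1"
    using f_dvd by (simp add: g_def)
  have zn: "z ^ n = 1"
    using ac_eval_root_if_dvd[OF f_dvd root] by simp
  \<comment> \<open>This bound allows the congruence to be read in the naturals as
    \<open>s * s = 1 + k * n\<close>.\<close>
  have "s * s \<ge> 1"
    using assms(3) by simp
  then obtain k where k: "s * s = 1 + k * n"
    using assms(4) by (metis cong_le_nat cong_sym_eq power2_eq_square add.commute)
  have zs: "z ^ (s * s) = z"
    unfolding k using zn by (simp add: power_add mult.commute[of k] power_mult)
  note nz = z_nonzero[OF n zn zs]
  define a b where "a = ac_eval z l" and "b = ac_eval (z ^ s) l"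
  have l: "f dvd (Polynomial.monom 1 (s - 1) - 1) * l - 1"
    using assms(11) by (simp add: cong_iff_dvd_diff)
  \<comment> \<open>These are the values of \<open>x^(s - 1)\<close> at the roots \<open>z\<close>
    and \<open>z ^ s\<close>. The exponents add up to \<open>(s - 1) + s * (s - 1)\<close>, one less
    than \<open>s * s\<close>, so the two values are inverse to each other.\<close>
  define \<beta> \<gamma> where "\<beta> = z ^ (s - 1)" and "\<gamma> = (z ^ s) ^ (s - 1)"
  have l1: "(\<beta> - 1) * a = 1" and l2: "(\<gamma> - 1) * b = 1"
    using ac_eval_root_if_dvd[OF l root] ac_eval_root_if_dvd[OF l root_s]
    by (simp_all add: a_def b_def \<beta>_def \<gamma>_def)
  have "z * (\<beta> * \<gamma>) = z ^ (1 + (s - 1) + s * (s - 1))"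
    by (simp add: \<beta>_def \<gamma>_def power_add power_mult)
  also have "1 + (s - 1) + s * (s - 1) = s * s"
    using assms(3) by (cases s) auto
  finally have \<beta>\<gamma>: "\<beta> * \<gamma> = 1"
    using zs nz by simp
  \<comment> \<open>Here \<open>a = 1 / (\<beta> - 1)\<close>, and
    \<open>\<gamma> = 1 / \<beta>\<close> gives \<open>b = \<beta> / (1 - \<beta>)\<close>; the sum
    is -1.\<close>
  have sum: "a + b = - 1"
    using l1 l2 \<beta>\<gamma> by Groebner_Basis.algebra
  have nonzero: "a \<noteq> 0" "\<beta> \<noteq> 1"
    using l1 by auto
  \<comment> \<open>Invertibility of \<open>x^(s - 1) - 1\<close> modulo \<open>f\<close> has
    excluded \<open>\<beta> = 1\<close>, which keeps the two roots apart.\<close>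
  have "z ^ s = z * \<beta>"
    using assms(3) by (cases s) (simp_all add: \<beta>_def)
  then have zs_neq: "z ^ s \<noteq> z"
    using nonzero nz by simp
  let ?h = "reciprocal_deg (Polynomial.degree f - 1) (pderiv (reflect_poly f))"
  \<comment> \<open>The polynomial behind \<theta>. It enters \<open>e_f1\<close> with the scalar 1
    and \<open>e_f2\<close> with the scalar -1.\<close>
  define T where "T = Polynomial.smult (- (1 / of_nat n)) ?h * g"
  have T: "g dvd T" "ac_eval z T = 1" "ac_eval (z ^ s) T = 1"
    unfolding T_def by (rule dvd_triv_right ac_eval_idempotent_poly[OF n_field n fg] root root_s)+
  note closed = split_closed[OF n zn zs]
  note mult = split_poly_mult[OF n zn zs, symmetric]
  let ?A = "group_algebra (split_group n s) :: (gen gword set \<Rightarrow> 'a) ring"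
  let ?P = "ga_poly (split_group n s) (split_x n s) :: 'a poly \<Rightarrow> _"
  let ?y = "ga_elem (split_y n s) :: _ \<Rightarrow> 'a"
  let ?v = "?P l \<otimes>\<^bsub>?A\<^esub> (\<one>\<^bsub>?A\<^esub> \<ominus>\<^bsub>?A\<^esub> ?y)"
  interpret A: ring ?A
    by (rule ring_group_algebra) (rule group_split_group)
  have v: "?v \<in> carrier ?A"
    using closed by (intro A.m_closed A.minus_closed A.one_closed)
  have T1: "Polynomial.smult 1 T = Polynomial.smult (- (1 / of_nat n)) ?h * g"
    and T2: "Polynomial.smult (- 1) T = Polynomial.smult (1 / of_nat n) ?h * g"
    by (simp_all add: T_def)
  have e1: "e_f1 n s f l = ?P (Polynomial.smult 1 T) \<otimes>\<^bsub>?A\<^esub> (?v \<oplus>\<^bsub>?A\<^esub> \<one>\<^bsub>?A\<^esub>)"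
    unfolding e_f1_def Let_def mult g_def[symmetric] T1 ..
  have e2: "e_f2 n s f l = ?P (Polynomial.smult (- 1) T) \<otimes>\<^bsub>?A\<^esub> ?v"
    unfolding e_f2_def Let_def mult g_def[symmetric] T2 ..
  note rep = split_rep_add[OF n zn zs] split_rep_mult[OF n zn zs] split_rep_poly[OF n zn zs]
    split_rep_one_minus_y[OF n zn zs]
  have rep_v: "split_rep n s z ?v = diag2 a b ** (mat 1 - swap2)"
    using closed by (simp only: rep) (simp add: a_def b_def)
  have rep_one: "split_rep n s z \<one>\<^bsub>?A\<^esub> = mat 1"
    using rep(3)[of 1] by (simp add: ga_poly_def matrix2_eq_iff)
  \<comment> \<open>Since \<open>T\<close> is 1 at both \<open>z\<close> and \<open>z ^ s\<close>,
    its image is the identity. The matrix has rows \<open>(a + 1, -a)\<close> and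
    \<open>(-b, b + 1)\<close>, so the determinant is \<open>a + b + 1 = 0\<close> and the trace
    \<open>a + b + 2 = 1\<close>.\<close>
  have E1: "split_rep n s z (e_f1 n s f l) = diag2 a b ** (mat 1 - swap2) + mat 1"
    unfolding e1 using closed T by (simp only: rep rep_v rep_one)
     (simp add: matrix2_eq_iff matrix2_mult_entry)
  \<comment> \<open>The rows are \<open>(-a, a)\<close> and \<open>(b, -b)\<close>: the determinant
    vanishes identically and the trace is \<open>-(a + b) = 1\<close>. As in the first matrix, the
    upper right entry is nonzero because \<open>a\<close> is.\<close>
  have E2: "split_rep n s z (e_f2 n s f l) = diag2 (- a) (- b) ** (mat 1 - swap2)"
    unfolding e2 using closed T by (simp only: rep rep_v)
     (simp add: matrix2_eq_iff matrix2_mult_entry)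
  have b: "b = - 1 - a"
    using sum by (simp add: algebra_simps eq_neg_iff_add_eq_0)
  note main = split_rank_one_primitive_noncentral[OF n zn zs assms(8) root fg T(1,2)]
  have "primitive_idempotent ?A (e_f1 n s f l) \<and> \<not> ring_central ?A (e_f1 n s f l)"
  proof (rule main[OF e1])
    show "?v \<oplus>\<^bsub>?A\<^esub> \<one>\<^bsub>?A\<^esub> \<in> carrier ?A"
      using v by (intro A.a_closed A.one_closed)
  qed (use nonzero zs_neq in \<open>simp_all add: E1 b det_2 trace_def sum_2 matrix2_mult_entry algebra_simps\<close>)
  moreover have "primitive_idempotent ?A (e_f2 n s f l) \<and> \<not> ring_central ?A (e_f2 n s f l)"
    by (rule main[OF e2 v])
     (use nonzero zs_neq in \<open>simp_all add: E2 b det_2 trace_def sum_2 matrix2_mult_entry algebra_simps\<close>)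
  ultimately show ?thesis
    by blast
qed

end
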